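(* Let $\tau>0$. (a) $\mathcal B_{c,\tau}$ with norm $\|\cdot\|_{\tau,\infty}$ is a Banach space isometrically isomorphic to $\mathcal B_c$ (with norm $\|G\|'_\infty=\sup_{x<y}|G(x)-G(y)|$). (b) $\mathcal A_{c,\tau}$ with norm $\|\cdot\|_\tau$ is a Banach space isometrically isomorphic to $\mathcal A_c$ (with the Alexiewicz norm). (c) A distribution $f$ belongs to $\mathcal A_{c,\tau}$ if and only if $f\omega_\tau\in\mathcal A_c$. (d) If $f\in\mathcal A_{c,\tau}$ then $\|f\|_\tau=\|f\omega_\tau\|$. (e) For each $\tau>0$, $\mathcal A_c\subsetneq\mathcal A_{c,\tau}$. (f) For $r,s>0$: $0<r<s$ if and only if $\mathcal A_{c,s}\subsetneq\mathcal A_{c,r}$. (g) If $f\in\mathcal A_{c,\tau}$ and $F(x)=\int_0^xf$, then $|F(x)|\le\|f\|_\tau e^{x^2/(4\tau)}$ for all $x\in\mathbb R$, and $F(x)=o(e^{x^2/(4\tau)})$ as $|x|\to\infty$. (h) If $0<r<s$ then $\mathcal A_{c,s}$ is a dense subspace of $\mathcal A_{c,r}$ (with respect to $\|\cdot\|_r$). (i) If $0<r<s$ then $\|f\|_r\le2\|f\|_s$ for each $f\in\mathcal A_{c,s}$. (j) Let $L^1(\omega_\tau)=\{f\in L^1_{loc}(\mathbb R): f\omega_\tau\in L^1(\mathbb R)\}$. Then $L^1(\omega_\tau)$ is dense in $\mathcal A_{c,\tau}$. (k) $\mathcal A_{c,\tau}$ is not closed under translation.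
   Context: Let $\mathcal B_c$ be the set of continuous $G:\mathbb R\to\mathbb R$ such that $\lim_{x\to\pm\infty}G(x)$ exist as real numbers and $\lim_{x\to-\infty}G(x)=0$, normed by $\|G\|'_\infty=\sup_{x<y}|G(x)-G(y)|$. Let $\mathcal A_c$ be the distributions $g=G'$ with $G\in\mathcal B_c$ (unique primitive), integral $\int_a^bg=G(b)-G(a)$, Alexiewicz norm $\|g\|=\sup_{x<y}|G(y)-G(x)|$. For $\tau>0$ let $\omega_\tau(x)=e^{-x^2/(4\tau)}$. For $G\in\mathcal B_c$ let $F_\tau$ be the unique continuous solution of the Volterra equation $G(x)-G(0)=F_\tau(x)\omega_\tau(x)+\frac1{2\tau}\int_0^xF_\tau(\xi)\xi\,\omega_\tau(\xi)\,d\xi$ (so $F_\tau(0)=0$; $G\leftrightarrow F_\tau$ is a bijection). Let $\mathcal B_{c,\tau}$ be the set of all such $F_\tau$ (as $G$ ranges over $\mathcal B_c$), with $\|F_\tau\|_{\tau,\infty}=\|G\|'_\infty$. Let $\mathcal A_{c,\tau}$ be the distributions $f=F_\tau'$ (distributional derivative) with $F_\tau\in\mathcal B_{c,\tau}$; the primitive $F_\tau$ is unique, and $\|f\|_\tau:=\|F_\tau\|_{\tau,\infty}$; for such $f$, $\int_a^bf=F_\tau(b)-F_\tau(a)$ for real $a,b$. The product $f\omega_\tau$ is the usual product of a distribution with a smooth function. Translation of a distribution $f$ by $a$ is $f(\cdot-a)$. *)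

theory Defs
  imports "HOL-Analysis.Analysis"
begin

definition omega :: "real \<Rightarrow> real \<Rightarrow> real" where
  "omega \<tau> x = exp (- (x\<^sup>2) / (4 * \<tau>))"

definition oint :: "real \<Rightarrow> real \<Rightarrow> (real \<Rightarrow> real) \<Rightarrow> real" where
  "oint a b f = (if a \<le> b then integral {a..b} f else - integral {b..a} f)"

definition test_fun :: "(real \<Rightarrow> real) \<Rightarrow> bool" where
  "test_fun \<phi> \<longleftrightarrow> (\<forall>k x. ((deriv ^^ k) \<phi>) differentiable (at x))
                   \<and> compact (closure {x. \<phi> x \<noteq> 0})"

text \<open>A distribution is represented as a functional on real functions that is
  linear and sequentially continuous on test functions and vanishes on
  non-test functions (normalisation, so that equality is extensional).\<close>
definition is_distribution :: "((real \<Rightarrow> real) \<Rightarrow> real) \<Rightarrow> bool" where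
  "is_distribution T \<longleftrightarrow>
     (\<forall>\<phi>. \<not> test_fun \<phi> \<longrightarrow> T \<phi> = 0) \<and>
     (\<forall>\<phi> \<psi> a b. test_fun \<phi> \<longrightarrow> test_fun \<psi> \<longrightarrow>
         T (\<lambda>x. a * \<phi> x + b * \<psi> x) = a * T \<phi> + b * T \<psi>) \<and>
     (\<forall>\<Phi> \<phi> K. compact K \<longrightarrow> (\<forall>n. test_fun (\<Phi> n) \<and> closure {x. \<Phi> n x \<noteq> 0} \<subseteq> K)
         \<longrightarrow> test_fun \<phi>
         \<longrightarrow> (\<forall>k. uniform_limit UNIV (\<lambda>n. (deriv ^^ k) (\<Phi> n)) ((deriv ^^ k) \<phi>) sequentially)
         \<longrightarrow> (\<lambda>n. T (\<Phi> n)) \<longlonglongrightarrow> T \<phi>)"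

definition dderiv :: "(real \<Rightarrow> real) \<Rightarrow> ((real \<Rightarrow> real) \<Rightarrow> real)" where
  "dderiv F = (\<lambda>\<phi>. if test_fun \<phi> then - integral UNIV (\<lambda>x. F x * deriv \<phi> x) else 0)"

definition regdist :: "(real \<Rightarrow> real) \<Rightarrow> ((real \<Rightarrow> real) \<Rightarrow> real)" where
  "regdist f = (\<lambda>\<phi>. if test_fun \<phi> then integral UNIV (\<lambda>x. f x * \<phi> x) else 0)"

definition mulw :: "real \<Rightarrow> ((real \<Rightarrow> real) \<Rightarrow> real) \<Rightarrow> ((real \<Rightarrow> real) \<Rightarrow> real)" where
  "mulw \<tau> T = (\<lambda>\<phi>. if test_fun \<phi> then T (\<lambda>x. omega \<tau> x * \<phi> x) else 0)"

text \<open>Translation: T(. - a) applied to phi is T(phi(. + a)).\<close>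
definition transl :: "real \<Rightarrow> ((real \<Rightarrow> real) \<Rightarrow> real) \<Rightarrow> ((real \<Rightarrow> real) \<Rightarrow> real)" where
  "transl a T = (\<lambda>\<phi>. if test_fun \<phi> then T (\<lambda>x. \<phi> (x + a)) else 0)"

definition Bc :: "(real \<Rightarrow> real) set" where
  "Bc = {G. continuous_on UNIV G \<and> (\<exists>l. (G \<longlongrightarrow> l) at_top) \<and> (G \<longlongrightarrow> 0) at_bot}"

definition bnorm :: "(real \<Rightarrow> real) \<Rightarrow> real" where
  "bnorm G = Sup {\<bar>G x - G y\<bar> | x y. x < y}"

definition Ac :: "((real \<Rightarrow> real) \<Rightarrow> real) set" where
  "Ac = {dderiv G | G. G \<in> Bc}"

definition prim :: "((real \<Rightarrow> real) \<Rightarrow> real) \<Rightarrow> (real \<Rightarrow> real)" where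
  "prim f = (THE G. G \<in> Bc \<and> f = dderiv G)"

definition alex :: "((real \<Rightarrow> real) \<Rightarrow> real) \<Rightarrow> real" where
  "alex f = bnorm (prim f)"

definition volterra :: "real \<Rightarrow> (real \<Rightarrow> real) \<Rightarrow> (real \<Rightarrow> real) \<Rightarrow> bool" where
  "volterra \<tau> G F \<longleftrightarrow> (\<forall>x. G x - G 0 = F x * omega \<tau> x
        + (1 / (2 * \<tau>)) * oint 0 x (\<lambda>\<xi>. F \<xi> * \<xi> * omega \<tau> \<xi>))"

definition Bct :: "real \<Rightarrow> (real \<Rightarrow> real) set" where
  "Bct \<tau> = {F. continuous_on UNIV F \<and> (\<exists>G \<in> Bc. volterra \<tau> G F)}"

definition norm_Bct :: "real \<Rightarrow> (real \<Rightarrow> real) \<Rightarrow> real" where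
  "norm_Bct \<tau> F = bnorm (THE G. G \<in> Bc \<and> volterra \<tau> G F)"

definition Act :: "real \<Rightarrow> ((real \<Rightarrow> real) \<Rightarrow> real) set" where
  "Act \<tau> = {dderiv F | F. F \<in> Bct \<tau>}"

definition prim_t :: "real \<Rightarrow> ((real \<Rightarrow> real) \<Rightarrow> real) \<Rightarrow> (real \<Rightarrow> real)" where
  "prim_t \<tau> f = (THE F. F \<in> Bct \<tau> \<and> f = dderiv F)"

definition norm_Act :: "real \<Rightarrow> ((real \<Rightarrow> real) \<Rightarrow> real) \<Rightarrow> real" where
  "norm_Act \<tau> f = norm_Bct \<tau> (prim_t \<tau> f)"

definition L1w :: "real \<Rightarrow> (real \<Rightarrow> real) set" where
  "L1w \<tau> = {f. (\<forall>a b. f absolutely_integrable_on {a..b})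
              \<and> (\<lambda>x. f x * omega \<tau> x) absolutely_integrable_on UNIV}"

definition lin_subspace_fun :: "('a \<Rightarrow> real) set \<Rightarrow> bool" where
  "lin_subspace_fun S \<longleftrightarrow> (\<lambda>_. 0) \<in> S \<and>
     (\<forall>f\<in>S. \<forall>g\<in>S. (\<lambda>x. f x + g x) \<in> S) \<and> (\<forall>c. \<forall>f\<in>S. (\<lambda>x. c * f x) \<in> S)"

definition banach_fun_on :: "('a \<Rightarrow> real) set \<Rightarrow> (('a \<Rightarrow> real) \<Rightarrow> real) \<Rightarrow> bool" where
  "banach_fun_on S N \<longleftrightarrow> lin_subspace_fun S \<and>
     (\<forall>f\<in>S. N f \<ge> 0 \<and> (N f = 0 \<longleftrightarrow> f = (\<lambda>_. 0))) \<and>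
     (\<forall>c. \<forall>f\<in>S. N (\<lambda>x. c * f x) = \<bar>c\<bar> * N f) \<and>
     (\<forall>f\<in>S. \<forall>g\<in>S. N (\<lambda>x. f x + g x) \<le> N f + N g) \<and>
     (\<forall>X. (\<forall>n. X n \<in> S) \<longrightarrow>
        (\<forall>e>0. \<exists>M. \<forall>m\<ge>M. \<forall>n\<ge>M. N (\<lambda>x. X m x - X n x) < e) \<longrightarrow>
        (\<exists>L\<in>S. (\<lambda>n. N (\<lambda>x. X n x - L x)) \<longlonglongrightarrow> 0))"

definition isometric_iso_fun ::
  "('a \<Rightarrow> real) set \<Rightarrow> (('a \<Rightarrow> real) \<Rightarrow> real) \<Rightarrow> ('b \<Rightarrow> real) set \<Rightarrow> (('b \<Rightarrow> real) \<Rightarrow> real) \<Rightarrow> bool" where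
  "isometric_iso_fun S N T M \<longleftrightarrow> (\<exists>h. bij_betw h S T \<and>
     (\<forall>f\<in>S. \<forall>g\<in>S. h (\<lambda>x. f x + g x) = (\<lambda>x. h f x + h g x)) \<and>
     (\<forall>c. \<forall>f\<in>S. h (\<lambda>x. c * f x) = (\<lambda>x. c * h f x)) \<and>
     (\<forall>f\<in>S. M (h f) = N f))"

end

theory Submission
  imports Defs "HOL-Computational_Algebra.Polynomial" "HOL-Real_Asymp.Real_Asymp"
begin

text \<open>For real c put wprim c F (x) = F(x) exp (- c x^2) + 2 c (integral of F(t) t exp (- c t^2) over [0, x]),
  that is, the Stieltjes integral of exp (- c x^2) against dF plus the constant F(0). Multiplying the
  distribution F' by exp (- c x^2) gives the derivative of wprim c F, and wprim a (wprim b F) = wprim (a + b) F.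
  Hence the Volterra equation is solved by wprim (- c) with c = 1 / (4 tau), and every space in
  the theorem is the image under some wprim (- c) of the continuous functions having finite limits at both
  ends. The inclusions and norm bounds follow since wprim c contracts for c >= 0; density follows since any
  wprim c maps a function that is constant near both ends to one of the same kind.\<close>

section \<open>Test functions\<close>

text \<open>Three normalisations compete: members of \<open>Bc\<close> vanish at minus infinity,
  members of \<open>Bct \<tau>\<close> vanish at 0, and \<open>wprim\<close> preserves the value at
  0. On continuous functions \<open>dderiv\<close> and \<open>bnorm\<close> are blind to constants,
  so most arguments run in \<open>Cends\<close>, where no constant is fixed, and a normalisation is
  restored only where a definition asks for it. The primitives are merely continuous, so the
  Stieltjes integral is not taken literally: integration by parts is built into the formula for
  \<open>wprim\<close>, and its basic identities are checked by differentiating the integral terms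
  and not F. The norms are defined through definite descriptions, hence primitives must be unique: a
  continuous function with zero distributional derivative is constant. This is why explicit bump
  functions have to be constructed. The asymmetry behind the strict inclusions is that
  \<open>wprim c\<close> maps \<open>Cends\<close> into itself for c \<ge> 0 but not for c < 0. Part
  (j) needs one more tool, integration by parts with a factor that is only locally absolutely
  integrable.\<close>

definition smooth :: "(real \<Rightarrow> real) \<Rightarrow> bool" where
  "smooth f \<longleftrightarrow> (\<forall>k x. (deriv ^^ k) f differentiable (at x))"

text \<open>A family of functions that is closed under differentiation consists of smooth functions.
  Each smoothness proof thus reduces to guessing such a family, and no iterated derivative is ever
  computed.\<close>

lemma smooth_coinduct:
  assumes "P f" and "\<And>f. P f \<Longrightarrow> \<exists>g. P g \<and> (\<forall>x. (f has_real_derivative g x) (at x))"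
  shows "smooth f"
proof -
  have step: "P (deriv f) \<and> (\<forall>x. f differentiable (at x))" if Pf: "P f" for f
  proof -
    obtain g where g: "P g" "\<And>x. (f has_real_derivative g x) (at x)"
      using assms(2)[OF Pf] by blast
    have "deriv f = g"
      using g(2) DERIV_imp_deriv by blast
    then show ?thesis
      using g real_differentiable_def by blast
  qed
  have "P ((deriv ^^ k) f)" for k
    by (induction k) (use assms(1) step in auto)
  then show ?thesis
    unfolding smooth_def using step by blast
qed

lemma smooth_DERIV: "smooth f \<Longrightarrow> (f has_real_derivative deriv f x) (at x)"
  unfolding smooth_def
  by (metis DERIV_deriv_iff_real_differentiable funpow_0)

lemma smooth_deriv: "smooth f \<Longrightarrow> smooth (deriv f)"
  unfolding smooth_def by (metis funpow_Suc_right o_apply)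

lemma smooth_continuous: "smooth f \<Longrightarrow> continuous_on S f"
  using smooth_DERIV DERIV_continuous_on has_field_derivative_at_within by blast

text \<open>The derivative of a product is a sum of two products, so products alone are not closed
  under differentiation. The closure under sums and products is, and serves as the coinduction
  family.\<close>

inductive smooth_alg :: "(real \<Rightarrow> real) \<Rightarrow> bool" where
  base: "smooth f \<Longrightarrow> smooth_alg f"
| add: "smooth_alg f \<Longrightarrow> smooth_alg g \<Longrightarrow> smooth_alg (\<lambda>x. f x + g x)"
| mult: "smooth_alg f \<Longrightarrow> smooth_alg g \<Longrightarrow> smooth_alg (\<lambda>x. f x * g x)"

lemma smooth_alg_smooth: "smooth_alg f \<Longrightarrow> smooth f"
proof (erule smooth_coinduct)
  fix f :: "real \<Rightarrow> real" assume "smooth_alg f"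
  then show "\<exists>g. smooth_alg g \<and> (\<forall>x. (f has_real_derivative g x) (at x))"
  proof induction
    case (base f)
    then show ?case
      using smooth_DERIV smooth_deriv smooth_alg.base by blast
  next
    case (add f g)
    then obtain f' g' where *: "smooth_alg f'" "\<And>x. (f has_real_derivative f' x) (at x)"
       "smooth_alg g'" "\<And>x. (g has_real_derivative g' x) (at x)" by blast
    show ?case
      by (rule exI[of _ "\<lambda>x. f' x + g' x"]) (auto intro!: smooth_alg.add DERIV_add *)
  next
    case (mult f g)
    then obtain f' g' where *: "smooth_alg f'" "\<And>x. (f has_real_derivative f' x) (at x)"
       "smooth_alg g'" "\<And>x. (g has_real_derivative g' x) (at x)" by blast
    show ?case
      by (rule exI[of _ "\<lambda>x. f' x * g x + g' x * f x"])
         (auto intro!: smooth_alg.intros(2,3) DERIV_mult * mult)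
  qed
qed

lemma smooth_add: "smooth f \<Longrightarrow> smooth g \<Longrightarrow> smooth (\<lambda>x. f x + g x)"
  and smooth_mult: "smooth f \<Longrightarrow> smooth g \<Longrightarrow> smooth (\<lambda>x. f x * g x)"
  by (blast intro: smooth_alg.intros smooth_alg_smooth)+

lemma smooth_const: "smooth (\<lambda>x. c)"
  by (rule smooth_coinduct[where P = "\<lambda>f. \<exists>c. f = (\<lambda>x. c)"]) (auto intro!: derivative_eq_intros)

lemma smooth_affine:
  assumes "smooth f"
  shows "smooth (\<lambda>x. f (a * x + b))"
\<comment> \<open>The scalar k collects the powers of a that the chain rule produces.\<close>
proof (rule smooth_coinduct[where P = "\<lambda>g. \<exists>f k. smooth f \<and> g = (\<lambda>x. k * f (a * x + b))"])
  show "\<exists>f' k. smooth f' \<and> (\<lambda>x. f (a * x + b)) = (\<lambda>x. k * f' (a * x + b))"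
    by (rule exI[of _ f], rule exI[of _ 1]) (use assms in auto)
next
  fix g assume "\<exists>f k. smooth f \<and> g = (\<lambda>x. k * f (a * x + b))"
  then obtain f k where f: "smooth f" and g: "g = (\<lambda>x. k * f (a * x + b))" by blast
  have "(g has_real_derivative (k * a) * deriv f (a * x + b)) (at x)" for x
    unfolding g by (auto intro!: derivative_eq_intros DERIV_chain2[OF smooth_DERIV[OF f]])
  then show "\<exists>g'. (\<exists>f k. smooth f \<and> g' = (\<lambda>x. k * f (a * x + b))) \<and>
             (\<forall>x. (g has_real_derivative g' x) (at x))"
    using smooth_deriv[OF f]
    by (intro exI[of _ "\<lambda>x. (k * a) * deriv f (a * x + b)"]) blast
qed

section \<open>Gaussians and flat functions\<close>

text \<open>Polynomial multiples of the Gaussian form the invariant family: differentiation replaces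
  p by p' + 2 c x p.\<close>

lemma smooth_gaussian: "smooth (\<lambda>x. exp (c * x\<^sup>2))"
proof (rule smooth_coinduct[where P = "\<lambda>g. \<exists>p. g = (\<lambda>x. poly p x * exp (c * x\<^sup>2))"])
  show "\<exists>p. (\<lambda>x. exp (c * x\<^sup>2)) = (\<lambda>x. poly p x * exp (c * x\<^sup>2))"
    by (rule exI[of _ 1]) auto
next
  fix g :: "real \<Rightarrow> real" assume "\<exists>p. g = (\<lambda>x. poly p x * exp (c * x\<^sup>2))"
  then obtain p where p: "g = (\<lambda>x. poly p x * exp (c * x\<^sup>2))" by blast
  have "(g has_real_derivative (poly (pderiv p + [:0, 2 * c:] * p) x * exp (c * x\<^sup>2))) (at x)" for x
    unfolding p by (auto intro!: derivative_eq_intros poly_DERIV simp: algebra_simps)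
  then show "\<exists>g'. (\<exists>p. g' = (\<lambda>x. poly p x * exp (c * x\<^sup>2))) \<and>
             (\<forall>x. (g has_real_derivative g' x) (at x))"
    by (intro exI[of _ "\<lambda>x. poly (pderiv p + [:0, 2 * c:] * p) x * exp (c * x\<^sup>2)"]) blast
qed

text \<open>With y = 1 / h this says that exp (- 1 / h) beats every negative power of h as h
  decreases to 0, which gives the derivative of the flat functions at 0.\<close>

lemma poly_exp_neg_at_top: "((\<lambda>y::real. poly p y * exp (- y)) \<longlongrightarrow> 0) at_top"
proof (induction p)
  case 0
  then show ?case by simp
next
  case (pCons a p)
  have *: "((\<lambda>y::real. y * poly p y * exp (- y)) \<longlongrightarrow> 0) at_top" for p
  proof -
    have "((\<lambda>y::real. \<Sum>i\<le>degree p. coeff p i * (y ^ Suc i * exp (- y))) \<longlongrightarrow> (\<Sum>i\<le>degree p. coeff p i * 0)) at_top"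
    proof (intro tendsto_intros)
      fix i :: nat
      have "((\<lambda>y::real. y ^ Suc i / exp y) \<longlongrightarrow> 0) at_top"
        by (rule tendsto_power_div_exp_0)
      then show "((\<lambda>y::real. y ^ Suc i * exp (- y)) \<longlongrightarrow> 0) at_top"
        by (simp add: exp_minus field_simps)
    qed
    then show ?thesis
      by (simp add: poly_altdef sum_distrib_left sum_distrib_right algebra_simps)
  qed
  have "((\<lambda>y::real. a * exp (- y) + y * poly p y * exp (- y)) \<longlongrightarrow> a * 0 + 0) at_top"
    by (intro tendsto_intros *) real_asymp
  then show ?case
    by (simp add: algebra_simps)
qed

text \<open>With p = 1 this is the flat function exp (- 1 / x); the polynomial factors make the family closed
  under differentiation.\<close>

definition flat_fun :: "real poly \<Rightarrow> real \<Rightarrow> real" where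
  "flat_fun p x = (if x > 0 then poly p (1 / x) * exp (- (1 / x)) else 0)"

text \<open>In the variable y = 1 / x the derivative d/dx is - y^2 d/dy, and it takes p(y) exp (- y)
  to y^2 (p - p')(y) exp (- y).\<close>

lemma flat_fun_DERIV:
  "(flat_fun p has_real_derivative flat_fun ([:0, 0, 1:] * (p - pderiv p)) x) (at x)"
proof -
  consider "x > 0" | "x < 0" | "x = 0" by linarith
  then show ?thesis
  proof cases
    case 1
    have "((\<lambda>x. poly p (1 / x) * exp (- (1 / x))) has_real_derivative
        flat_fun ([:0, 0, 1:] * (p - pderiv p)) x) (at x)"
      using 1 by (auto intro!: derivative_eq_intros DERIV_chain2[OF poly_DERIV]
          simp: flat_fun_def power2_eq_square field_simps)
    then show ?thesis
      by (rule has_field_derivative_transform_within_open[where S = "{0<..}"])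
         (use 1 in \<open>auto simp: flat_fun_def\<close>)
  next
    case 2
    have "((\<lambda>x. 0) has_real_derivative flat_fun ([:0, 0, 1:] * (p - pderiv p)) x) (at x)"
      using 2 by (auto simp: flat_fun_def)
    then show ?thesis
      by (rule has_field_derivative_transform_within_open[where S = "{..<0}"])
         (use 2 in \<open>auto simp: flat_fun_def\<close>)
  next
    case 3
    \<comment> \<open>The difference quotient at 0 carries an extra factor 1 / h, which is absorbed
      into the polynomial.\<close>
    have "((\<lambda>h. poly ([:0, 1:] * p) (1 / h) * exp (- (1 / h))) \<longlongrightarrow> 0) (at_right 0)"
      using filterlim_compose[OF poly_exp_neg_at_top[of "[:0, 1:] * p"] filterlim_inverse_at_top_right]
      by (simp only: inverse_eq_divide)
    then have r: "((\<lambda>h. flat_fun p h / h) \<longlongrightarrow> 0) (at_right 0)"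
      by (rule Lim_transform_eventually)
         (auto simp: flat_fun_def eventually_at_right_field intro!: exI[of _ 1])
    have l: "((\<lambda>h. flat_fun p h / h) \<longlongrightarrow> 0) (at_left 0)"
      by (rule Lim_transform_eventually[OF tendsto_const])
         (auto simp: flat_fun_def eventually_at_left_field intro!: exI[of _ "-1"])
    show ?thesis
      using 3 filterlim_split_at[OF l r]
      by (simp add: DERIV_def flat_fun_def)
  qed
qed

lemma smooth_flat_fun: "smooth (flat_fun p)"
  by (rule smooth_coinduct[where P = "\<lambda>g. \<exists>p. g = flat_fun p"]) (use flat_fun_DERIV in blast)+

section \<open>Bumps and supports of test functions\<close>

lemma test_fun_iff:
  "test_fun \<phi> \<longleftrightarrow> smooth \<phi> \<and> (\<exists>M. \<forall>x. \<phi> x \<noteq> 0 \<longrightarrow> \<bar>x\<bar> \<le> M)"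
  unfolding test_fun_def smooth_def compact_closure bounded_real by auto

text \<open>One flat function switches on to the right of a, a reflected one switches off at b;
  their product is the bump.\<close>

lemma bump_exists:
  assumes "a < b"
  obtains \<eta> where "test_fun \<eta>" "\<And>x. x \<in> {a<..<b} \<Longrightarrow> \<eta> x > 0" "\<And>x. x \<notin> {a<..<b} \<Longrightarrow> \<eta> x = 0"
proof
  let ?\<eta> = "\<lambda>x. flat_fun 1 (1 * x + (- a)) * flat_fun 1 ((- 1) * x + b)"
  show "test_fun ?\<eta>"
    unfolding test_fun_iff
    by (intro conjI smooth_mult smooth_affine smooth_flat_fun exI[of _ "\<bar>a\<bar> + \<bar>b\<bar>"])
       (auto simp: flat_fun_def)
qed (auto simp: flat_fun_def)

lemma test_fun_obtain_support:
  assumes "test_fun \<phi>"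
  obtains M where "M > 0" "\<And>x. \<bar>x\<bar> \<ge> M \<Longrightarrow> \<phi> x = 0" "\<And>x. \<bar>x\<bar> \<ge> M \<Longrightarrow> deriv \<phi> x = 0"
proof -
  obtain M where M: "\<And>x. \<phi> x \<noteq> 0 \<Longrightarrow> \<bar>x\<bar> \<le> M"
    using assms test_fun_iff by blast
  \<comment> \<open>The function is zero on the open set beyond |M|; the extra 1 keeps the end
    points of the new support interval inside that set.\<close>
  have "deriv \<phi> x = 0" if "\<bar>x\<bar> \<ge> \<bar>M\<bar> + 1" for x
  proof -
    have "((\<lambda>x. 0) has_real_derivative 0) (at x)" by simp
    then have "(\<phi> has_real_derivative 0) (at x)"
      by (rule has_field_derivative_transform_within_open[where S = "{x. \<bar>x\<bar> > \<bar>M\<bar>}"])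
         (use that M in \<open>force intro!: open_Collect_less continuous_intros\<close>)+
    then show ?thesis by (rule DERIV_imp_deriv)
  qed
  then show thesis
    using M by (intro that[of "\<bar>M\<bar> + 1"]) force+
qed

lemma test_fun_deriv: "test_fun \<phi> \<Longrightarrow> test_fun (deriv \<phi>)"
  by (metis test_fun_iff smooth_deriv test_fun_obtain_support less_eq_real_def not_le_imp_less)

lemma test_fun_mult:
  assumes "smooth f" "test_fun \<phi>"
  shows "test_fun (\<lambda>x. f x * \<phi> x)"
  using assms unfolding test_fun_iff by (auto intro: smooth_mult)

lemma test_fun_shift:
  assumes "test_fun \<phi>"
  shows "test_fun (\<lambda>x. \<phi> (x + a))"
proof -
  obtain M where M: "\<And>x. \<phi> x \<noteq> 0 \<Longrightarrow> \<bar>x\<bar> \<le> M"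
    using assms test_fun_iff by blast
  have "\<bar>x\<bar> \<le> M + \<bar>a\<bar>" if "\<phi> (x + a) \<noteq> 0" for x
    using M[OF that] by linarith
  then show ?thesis
    using smooth_affine[of \<phi> 1 a] assms unfolding test_fun_iff by auto
qed

section \<open>Distributional derivatives of continuous functions\<close>

text \<open>Moving the base point to the left of both 0 and x turns the oriented integral into a
  difference of ordinary ones, so that later proofs need no case split on the sign of x.\<close>

lemma oint_eq_diff:
  assumes "\<And>a b. f integrable_on {a..b}" and "a \<le> 0" "a \<le> x"
  shows "oint 0 x f = integral {a..x} f - integral {a..0} f"
proof (cases "0 \<le> x")
  case True
  then show ?thesis
    using Henstock_Kurzweil_Integration.integral_combine[of a 0 x f] assms by (simp add: oint_def)
next
  case False
  then show ?thesis
    using Henstock_Kurzweil_Integration.integral_combine[of a x 0 f] assms by (simp add: oint_def)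
qed

lemma oint_diff:
  assumes "\<And>a b. f integrable_on {a..b}" and "x \<le> y"
  shows "oint 0 y f - oint 0 x f = integral {x..y} f"
  using Henstock_Kurzweil_Integration.integral_combine[of "min 0 x" x y f] assms
  by (simp add: oint_eq_diff[OF assms(1), of "min 0 x"])

lemma continuous_integrable_Icc: "continuous_on UNIV f \<Longrightarrow> (f::real \<Rightarrow> real) integrable_on {a..b}"
  by (meson continuous_on_subset integrable_continuous_real subset_UNIV)

lemma oint_DERIV:
  assumes "continuous_on UNIV f"
  shows "((\<lambda>x. oint 0 x f) has_real_derivative f x) (at x)"
proof -
  define a where "a = min 0 x - 1"
  have "((\<lambda>y. integral {a..y} f) has_real_derivative f x) (at x within {a..x + 1})"
    by (rule integral_has_real_derivative)
       (use assms in \<open>auto simp: a_def intro: continuous_on_subset\<close>)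
  then have "((\<lambda>y. integral {a..y} f) has_real_derivative f x) (at x)"
    by (simp add: at_within_Icc_at a_def)
  then have "((\<lambda>y. integral {a..y} f - integral {a..0} f) has_real_derivative f x) (at x)"
    by (auto intro!: derivative_eq_intros)
  then show ?thesis
    by (rule has_field_derivative_transform_within_open[where S = "{a<..}"])
       (auto simp: a_def oint_eq_diff[OF continuous_integrable_Icc[OF assms], of "min 0 x - 1"])
qed

lemma oint_FTC:
  assumes "\<And>x. (\<Phi> has_real_derivative f x) (at x)"
  shows "oint 0 x f = \<Phi> x - \<Phi> 0"
proof -
  have "integral {a..b} f = \<Phi> b - \<Phi> a" if "a \<le> b" for a b
    by (rule integral_unique, rule fundamental_theorem_of_calculus[OF that])
       (use assms has_field_derivative_at_within has_real_derivative_iff_has_vector_derivative in blast)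
  then show ?thesis by (simp add: oint_def)
qed

lemma oint_continuous_on: "continuous_on UNIV f \<Longrightarrow> continuous_on UNIV (\<lambda>x. oint 0 x f)"
  by (rule continuous_at_imp_continuous_on) (blast intro: DERIV_isCont oint_DERIV)

lemma oint_0 [simp]: "oint 0 0 f = 0"
  by (simp add: oint_def)

lemma oint_add:
  assumes "\<And>a b. f integrable_on {a..b}" "\<And>a b. g integrable_on {a..b}"
  shows "oint 0 x (\<lambda>\<xi>. f \<xi> + g \<xi>) = oint 0 x f + oint 0 x g"
  using assms by (simp add: oint_def Henstock_Kurzweil_Integration.integral_add)

lemma oint_cmult: "oint 0 x (\<lambda>\<xi>. c * f \<xi>) = c * oint 0 x f"
  by (simp add: oint_def)

section \<open>Integration against test functions\<close>

lemma has_integral_UNIV_of_support: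
  fixes f :: "real \<Rightarrow> real"
  assumes "\<And>x. \<bar>x\<bar> \<ge> M \<Longrightarrow> f x = 0" "(f has_integral I) {-M..M}"
  shows "(f has_integral I) UNIV"
  by (rule has_integral_on_superset[OF assms(2)]) (use assms(1) in auto)

lemma integrable_continuous_test:
  assumes "continuous_on UNIV F" "test_fun \<phi>"
  shows "(\<lambda>x. F x * \<phi> x) integrable_on UNIV"
proof -
  obtain M where M: "M > 0" "\<And>x. \<bar>x\<bar> \<ge> M \<Longrightarrow> \<phi> x = 0"
    using test_fun_obtain_support[OF assms(2)] by metis
  have "continuous_on UNIV (\<lambda>x. F x * \<phi> x)"
    using assms(1) assms(2)[unfolded test_fun_iff]
    by (intro continuous_on_mult) (auto intro: smooth_continuous)
  then have "((\<lambda>x. F x * \<phi> x) has_integral integral {-M..M} (\<lambda>x. F x * \<phi> x)) {-M..M}"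
    using continuous_integrable_Icc by blast
  then show ?thesis
    using has_integral_UNIV_of_support[of M "\<lambda>x. F x * \<phi> x"] M(2) by (auto simp: integrable_on_def)
qed

lemma has_integral_DERIV_support:
  fixes f :: "real \<Rightarrow> real"
  assumes "\<And>x. (\<Phi> has_real_derivative f x) (at x)"
    and "M > 0" "\<And>x. \<bar>x\<bar> \<ge> M \<Longrightarrow> \<Phi> x = 0" "\<And>x. \<bar>x\<bar> \<ge> M \<Longrightarrow> f x = 0"
  shows "(f has_integral 0) UNIV"
proof (rule has_integral_UNIV_of_support[OF assms(4)])
  have "(f has_integral (\<Phi> M - \<Phi> (-M))) {-M..M}"
    by (rule fundamental_theorem_of_calculus)
       (use assms(1,2) in \<open>auto simp flip: has_real_derivative_iff_has_vector_derivative
          intro: has_field_derivative_at_within\<close>)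
  then show "(f has_integral 0) {-M..M}"
    using assms(2,3) by simp
qed

lemma integral_parts_test:
  assumes "\<And>x. (F has_real_derivative f x) (at x)" "continuous_on UNIV f" "test_fun \<phi>"
  shows "integral UNIV (\<lambda>x. F x * deriv \<phi> x) = - integral UNIV (\<lambda>x. f x * \<phi> x)"
proof -
  obtain M where M: "M > 0" "\<And>x. \<bar>x\<bar> \<ge> M \<Longrightarrow> \<phi> x = 0" "\<And>x. \<bar>x\<bar> \<ge> M \<Longrightarrow> deriv \<phi> x = 0"
    using test_fun_obtain_support[OF assms(3)] by metis
  have sm: "smooth \<phi>" using assms(3) by (simp add: test_fun_iff)
  have F: "continuous_on UNIV F"
    using assms(1) DERIV_isCont continuous_at_imp_continuous_on by blast
  have "((\<lambda>x. f x * \<phi> x + F x * deriv \<phi> x) has_integral 0) UNIV"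
    by (rule has_integral_DERIV_support[where \<Phi> = "\<lambda>x. F x * \<phi> x" and M = M])
       (use M in \<open>auto intro!: derivative_eq_intros assms(1) smooth_DERIV[OF sm]\<close>)
  moreover have "((\<lambda>x. f x * \<phi> x + F x * deriv \<phi> x) has_integral
      (integral UNIV (\<lambda>x. f x * \<phi> x) + integral UNIV (\<lambda>x. F x * deriv \<phi> x))) UNIV"
    by (intro has_integral_add integrable_integral integrable_continuous_test test_fun_deriv F assms)
  ultimately have "0 = integral UNIV (\<lambda>x. f x * \<phi> x) + integral UNIV (\<lambda>x. F x * deriv \<phi> x)"
    by (rule has_integral_unique)
  then show ?thesis by simp
qed

section \<open>The kernel of the distributional derivative\<close>

lemma dderiv_add:
  assumes "continuous_on UNIV F" "continuous_on UNIV G"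
  shows "dderiv (\<lambda>x. F x + G x) = (\<lambda>\<phi>. dderiv F \<phi> + dderiv G \<phi>)"
proof
  fix \<phi> show "dderiv (\<lambda>x. F x + G x) \<phi> = dderiv F \<phi> + dderiv G \<phi>"
    using Henstock_Kurzweil_Integration.integral_add[OF
        integrable_continuous_test[OF assms(1) test_fun_deriv]
        integrable_continuous_test[OF assms(2) test_fun_deriv], of \<phi> \<phi>]
    by (simp add: dderiv_def algebra_simps)
qed

lemma dderiv_cmult: "dderiv (\<lambda>x. c * F x) = (\<lambda>\<phi>. c * dderiv F \<phi>)"
  by (auto simp: dderiv_def fun_eq_iff mult.assoc)

lemma dderiv_diff:
  assumes "continuous_on UNIV F" "continuous_on UNIV G"
  shows "dderiv (\<lambda>x. F x - G x) = (\<lambda>\<phi>. dderiv F \<phi> - dderiv G \<phi>)"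
proof
  fix \<phi> show "dderiv (\<lambda>x. F x - G x) \<phi> = dderiv F \<phi> - dderiv G \<phi>"
    using Henstock_Kurzweil_Integration.integral_diff[OF
        integrable_continuous_test[OF assms(1) test_fun_deriv]
        integrable_continuous_test[OF assms(2) test_fun_deriv], of \<phi> \<phi>]
    by (simp add: dderiv_def algebra_simps)
qed

lemma dderiv_const: "dderiv (\<lambda>x. k) = (\<lambda>_. 0)"
proof
  show "dderiv (\<lambda>x. k) \<phi> = 0" for \<phi>
    using integral_parts_test[of "\<lambda>x. k" "\<lambda>x. 0" \<phi>] by (simp add: dderiv_def)
qed

lemma dderiv_diff_const: "continuous_on UNIV F \<Longrightarrow> dderiv (\<lambda>x. F x - k) = dderiv F"
  using dderiv_diff[of F "\<lambda>x. k"] by (simp add: dderiv_const)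

text \<open>Test against a primitive of the difference of a bump at a and its translate to b.\<close>

lemma dderiv_zero_imp_le:
  assumes F: "continuous_on UNIV F" and dF: "dderiv F = (\<lambda>_. 0)"
  shows "F a \<le> F b"
proof (rule ccontr)
  assume "\<not> F a \<le> F b"
  \<comment> \<open>The midpoint separates the values of F near a from those near b, so on each bump
    F - m has the sign with which that bump enters \<open>\<theta>\<close>.\<close>
  define m where "m = (F a + F b) / 2"
  have m: "F b < m" "m < F a" using \<open>\<not> F a \<le> F b\<close> by (auto simp: m_def)
  have isC: "isCont F x" for x using F continuous_on_eq_continuous_at by blast
  obtain d1 where d1: "d1 > 0" "\<And>x. dist x a < d1 \<Longrightarrow> dist (F x) (F a) < F a - m"
    using isC[of a] m(2) unfolding continuous_at_eps_delta by (metis diff_gt_0_iff_gt)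
  obtain d2 where d2: "d2 > 0" "\<And>x. dist x b < d2 \<Longrightarrow> dist (F x) (F b) < m - F b"
    using isC[of b] m(1) unfolding continuous_at_eps_delta by (metis diff_gt_0_iff_gt)
  define e where "e = min d1 d2"
  have e: "e > 0" "\<And>x. \<bar>x - a\<bar> < e \<Longrightarrow> F x > m" "\<And>x. \<bar>x - b\<bar> < e \<Longrightarrow> F x < m"
    using d1 d2 by (fastforce simp: e_def dist_real_def abs_less_iff)+
  obtain \<eta> where \<eta>: "test_fun \<eta>" "\<And>x. x \<in> {-e<..<e} \<Longrightarrow> \<eta> x > 0" "\<And>x. x \<notin> {-e<..<e} \<Longrightarrow> \<eta> x = 0"
    using bump_exists[of "-e" e] e(1) by auto
  have sm\<eta>: "smooth \<eta>" using \<eta>(1) by (simp add: test_fun_iff)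
  have C\<eta>: "continuous_on UNIV \<eta>" using smooth_continuous[OF sm\<eta>] .
  define P where "P x = oint 0 x \<eta>" for x
  have P': "(P has_real_derivative \<eta> x) (at x)" for x
    unfolding P_def by (rule oint_DERIV[OF C\<eta>])
  have Pd: "P y - P x = integral {x..y} \<eta>" if "x \<le> y" for x y
    unfolding P_def using oint_diff continuous_integrable_Icc[OF C\<eta>] that by blast
  have Pup: "P x = P e" if "x \<ge> e" for x
  proof -
    have "integral {e..x} \<eta> = integral {e..x} (\<lambda>x. 0)"
      by (rule Henstock_Kurzweil_Integration.integral_cong) (use \<eta>(3) in auto)
    then show ?thesis using Pd[OF that] by simp
  qed
  have Plo: "P x = P (-e)" if "x \<le> -e" for x
  proof -
    have "integral {x..-e} \<eta> = integral {x..-e} (\<lambda>x. 0)"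
      by (rule Henstock_Kurzweil_Integration.integral_cong) (use \<eta>(3) in auto)
    then show ?thesis using Pd[OF that] by simp
  qed
  define \<phi> where "\<phi> x = P (x - a) - P (x - b)" for x
  define \<theta> where "\<theta> x = \<eta> (x - a) - \<eta> (x - b)" for x
  have \<phi>': "(\<phi> has_real_derivative \<theta> x) (at x)" for x
    unfolding \<phi>_def \<theta>_def
    by (auto intro!: derivative_eq_intros DERIV_chain2[OF P'])
  have "smooth \<theta>"
    using smooth_add[OF smooth_affine[OF sm\<eta>, of 1 "-a"]
        smooth_mult[OF smooth_const[of "-1"] smooth_affine[OF sm\<eta>, of 1 "-b"]]]
    by (simp add: \<theta>_def[abs_def])
  then have "smooth \<phi>"
    using \<phi>' smooth_DERIV smooth_deriv
    by (intro smooth_coinduct[where P = "\<lambda>h. h = \<phi> \<or> smooth h"]) blast+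
  \<comment> \<open>P alone has no bounded support, but it is constant on either side of the bump,
    so its two translates cancel far out.\<close>
  moreover have "\<phi> x = 0" if "\<bar>x\<bar> > \<bar>a\<bar> + \<bar>b\<bar> + e" for x
  proof (cases "x > 0")
    case True
    then have "x - a \<ge> e" "x - b \<ge> e" using that by linarith+
    then show ?thesis using Pup[of "x - a"] Pup[of "x - b"] by (simp add: \<phi>_def)
  next
    case False
    then have "x - a \<le> -e" "x - b \<le> -e" using that by linarith+
    then show ?thesis using Plo[of "x - a"] Plo[of "x - b"] by (simp add: \<phi>_def)
  qed
  ultimately have \<phi>: "test_fun \<phi>"
    unfolding test_fun_iff by (metis not_le_imp_less)
  have d\<phi>: "deriv \<phi> = \<theta>" using \<phi>' DERIV_imp_deriv by blast
  have T\<theta>: "test_fun \<theta>" using test_fun_deriv[OF \<phi>] d\<phi> by simp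
  have C\<theta>: "continuous_on UNIV \<theta>" using T\<theta> by (simp add: test_fun_iff smooth_continuous)
  have "integral UNIV (\<lambda>x. F x * \<theta> x) = 0"
    using fun_cong[OF dF, of \<phi>] \<phi> d\<phi> by (simp add: dderiv_def)
  \<comment> \<open>Constants have zero distributional derivative, so m may be subtracted from F;
    this makes the integrand nonnegative while its integral stays zero.\<close>
  moreover have "integral UNIV (\<lambda>x. m * \<theta> x) = 0"
    using fun_cong[OF dderiv_const[of m], of \<phi>] \<phi> d\<phi> by (simp add: dderiv_def)
  ultimately have I0: "((\<lambda>x. F x * \<theta> x - m * \<theta> x) has_integral (0 - 0)) UNIV"
    by (metis has_integral_diff integrable_integral integrable_continuous_test[OF F T\<theta>]
        integrable_continuous_test[OF continuous_on_const T\<theta>])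
  have pos: "(F x - m) * \<eta> (x - a) \<ge> 0" for x
    using e(2)[of x] \<eta>(2,3)[of "x - a"] by (cases "\<bar>x - a\<bar> < e") (auto simp: abs_less_iff)
  have neg: "(F x - m) * \<eta> (x - b) \<le> 0" for x
    using e(3)[of x] \<eta>(2,3)[of "x - b"]
    by (cases "\<bar>x - b\<bar> < e") (auto simp: abs_less_iff intro: mult_nonpos_nonneg)
  have nonneg: "F x * \<theta> x - m * \<theta> x \<ge> 0" for x
    using pos[of x] neg[of x] by (simp add: \<theta>_def algebra_simps)
  define M where "M = \<bar>a\<bar> + 1"
  have "((\<lambda>x. F x * \<theta> x - m * \<theta> x) has_integral 0) (cbox (-M) M)"
  proof -
    have c: "(\<lambda>x. F x * \<theta> x - m * \<theta> x) integrable_on {-M..M}"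
      by (intro continuous_integrable_Icc continuous_intros F C\<theta>)
    have "integral {-M..M} (\<lambda>x. F x * \<theta> x - m * \<theta> x) \<le> integral UNIV (\<lambda>x. F x * \<theta> x - m * \<theta> x)"
      by (rule integral_subset_le[OF _ c]) (use I0 nonneg in auto)
    moreover have "integral {-M..M} (\<lambda>x. F x * \<theta> x - m * \<theta> x) \<ge> 0"
      by (rule Henstock_Kurzweil_Integration.integral_nonneg[OF c]) (use nonneg in auto)
    ultimately have "integral {-M..M} (\<lambda>x. F x * \<theta> x - m * \<theta> x) = 0"
      using I0 by (simp add: integral_unique)
    then show ?thesis using c by (simp add: has_integral_iff)
  qed
  then have "F a * \<theta> a - m * \<theta> a = 0"
    by (rule has_integral_0_cbox_imp_0[rotated 2])
       (use nonneg in \<open>auto simp: M_def intro!: continuous_intros continuous_on_subset[OF F] continuous_on_subset[OF C\<theta>]\<close>)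
  \<comment> \<open>The second bump does not reach a, because F lies below m on it whereas F a >
    m.\<close>
  moreover have "\<theta> a > 0"
    using e(1) e(3)[of a] m(2) \<eta>(2)[of 0] \<eta>(3)[of "a - b"] by (fastforce simp: \<theta>_def abs_less_iff)
  ultimately show False
    using m(2) by (simp add: flip: left_diff_distrib)
qed

lemma dderiv_eqD:
  assumes "continuous_on UNIV F" "continuous_on UNIV G" "dderiv F = dderiv G"
  shows "F x - F y = G x - G y"
proof -
  have "dderiv (\<lambda>x. F x - G x) = (\<lambda>_. 0)"
    using dderiv_diff[OF assms(1,2)] assms(3) by simp
  then have "F x - G x = F y - G y"
    by (intro antisym dderiv_zero_imp_le) (auto intro!: continuous_intros assms)
  then show ?thesis by simp
qed

section \<open>The Gaussian-weighted primitive\<close>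

text \<open>The parameter may have either sign: \<open>omega \<tau>\<close> is the case c = 1 / (4
  \<tau>) and its reciprocal the case c = - 1 / (4 \<tau>).\<close>

definition gauss :: "real \<Rightarrow> real \<Rightarrow> real" where
  "gauss c x = exp (- c * x\<^sup>2)"

definition wprim :: "real \<Rightarrow> (real \<Rightarrow> real) \<Rightarrow> real \<Rightarrow> real" where
  "wprim c F x = F x * gauss c x + 2 * c * oint 0 x (\<lambda>\<xi>. F \<xi> * \<xi> * gauss c \<xi>)"

lemma gauss_pos [simp]: "gauss c x > 0" "gauss c x \<noteq> 0" "gauss c x \<ge> 0"
  by (auto simp: gauss_def)

lemma gauss_at_0 [simp]: "gauss c 0 = 1"
  by (simp add: gauss_def)

lemma gauss_zero [simp]: "gauss 0 x = 1"
  by (simp add: gauss_def)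

lemma gauss_add: "gauss (a + b) x = gauss a x * gauss b x"
  by (simp add: gauss_def algebra_simps flip: exp_add)

lemma gauss_DERIV: "(gauss c has_real_derivative - (2 * c * x * gauss c x)) (at x)"
  unfolding gauss_def[abs_def] by (auto intro!: derivative_eq_intros)

lemma continuous_on_gauss [continuous_intros]: "continuous_on S (gauss c)"
  unfolding gauss_def[abs_def] by (intro continuous_intros)

lemma smooth_gauss: "smooth (gauss c)"
  using smooth_gaussian[of "-c"] by (simp add: gauss_def[abs_def])

lemma continuous_wprim_integrand:
  "continuous_on UNIV F \<Longrightarrow> continuous_on UNIV (\<lambda>\<xi>. F \<xi> * \<xi> * gauss c \<xi>)"
  by (intro continuous_intros)

lemma wprim_continuous: "continuous_on UNIV F \<Longrightarrow> continuous_on UNIV (wprim c F)"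
  unfolding wprim_def[abs_def]
  by (intro continuous_intros oint_continuous_on continuous_wprim_integrand) auto

lemma wprim_at_0 [simp]: "wprim c F 0 = F 0"
  by (simp add: wprim_def)

lemma wprim_zero [simp]: "wprim 0 F = F"
  by (simp add: wprim_def fun_eq_iff)

text \<open>A constant has no Stieltjes differential, so only its value at 0 survives. Hence
  constants may be subtracted before and after applying \<open>wprim\<close>.\<close>

lemma wprim_const [simp]: "wprim c (\<lambda>x. k) = (\<lambda>x. k)"
proof
  fix x
  have "oint 0 x (\<lambda>\<xi>. (2 * c) * (k * \<xi> * gauss c \<xi>)) = - k * gauss c x - (- k * gauss c 0)"
    by (rule oint_FTC) (auto intro!: derivative_eq_intros gauss_DERIV)
  then show "wprim c (\<lambda>x. k) x = k"
    unfolding oint_cmult by (simp add: wprim_def algebra_simps)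
qed

lemma wprim_add:
  assumes "continuous_on UNIV F" "continuous_on UNIV G"
  shows "wprim c (\<lambda>x. F x + G x) = (\<lambda>x. wprim c F x + wprim c G x)"
  using oint_add[OF continuous_integrable_Icc[OF continuous_wprim_integrand[OF assms(1)]]
      continuous_integrable_Icc[OF continuous_wprim_integrand[OF assms(2)]]]
  by (simp add: wprim_def fun_eq_iff algebra_simps)

lemma wprim_cmult: "wprim c (\<lambda>x. k * F x) = (\<lambda>x. k * wprim c F x)"
proof
  fix x
  have "oint 0 x (\<lambda>\<xi>. k * F \<xi> * \<xi> * gauss c \<xi>) = k * oint 0 x (\<lambda>\<xi>. F \<xi> * \<xi> * gauss c \<xi>)"
    using oint_cmult[of x k "\<lambda>\<xi>. F \<xi> * \<xi> * gauss c \<xi>"] by (simp add: mult.assoc)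
  then show "wprim c (\<lambda>x. k * F x) x = k * wprim c F x"
    by (simp add: wprim_def distrib_left)
qed

lemma wprim_diff:
  assumes "continuous_on UNIV F" "continuous_on UNIV G"
  shows "wprim c (\<lambda>x. F x - G x) = (\<lambda>x. wprim c F x - wprim c G x)"
  using wprim_add[OF assms(1), of "\<lambda>x. (-1) * G x"] wprim_cmult[of c "-1" G]
  by (simp add: assms continuous_on_minus)

lemma wprim_wprim:
  assumes F: "continuous_on UNIV F"
  shows "wprim a (wprim b F) = wprim (a + b) F"
proof
  fix x
  define I where "I x = oint 0 x (\<lambda>\<xi>. F \<xi> * \<xi> * gauss b \<xi>)" for x
  define K where "K x = oint 0 x (\<lambda>\<xi>. F \<xi> * \<xi> * gauss (a + b) \<xi>)" for x
  have I': "(I has_real_derivative F x * x * gauss b x) (at x)" for x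
    unfolding I_def by (rule oint_DERIV[OF continuous_wprim_integrand[OF F]])
  have K': "(K has_real_derivative F x * x * gauss (a + b) x) (at x)" for x
    unfolding K_def by (rule oint_DERIV[OF continuous_wprim_integrand[OF F]])
  have wb: "wprim b F = (\<lambda>x. F x * gauss b x + 2 * b * I x)"
    by (simp add: wprim_def I_def fun_eq_iff)
  \<comment> \<open>The iterated integral is evaluated by an explicit primitive: K - I *
    \<open>gauss a\<close> has derivative 2 a x I(x) \<open>gauss a x\<close>, which is integration
    by parts of the outer integral.\<close>
  have "oint 0 x (\<lambda>\<xi>. (2 * a) * (wprim b F \<xi> * \<xi> * gauss a \<xi>))
      = (2 * a * K x + 2 * b * (K x - I x * gauss a x)) - (2 * a * K 0 + 2 * b * (K 0 - I 0 * gauss a 0))"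
    by (rule oint_FTC)
       (auto intro!: derivative_eq_intros I' K' gauss_DERIV simp: wb gauss_add algebra_simps)
  then have "2 * a * oint 0 x (\<lambda>\<xi>. wprim b F \<xi> * \<xi> * gauss a \<xi>)
      = 2 * a * K x + 2 * b * (K x - I x * gauss a x)"
    unfolding oint_cmult by (simp add: K_def I_def)
  then show "wprim a (wprim b F) x = wprim (a + b) F x"
    unfolding wprim_def[of a "wprim b F"] wprim_def[of "a + b"] K_def[symmetric]
    by (simp add: wb gauss_add algebra_simps)
qed

text \<open>The derivative of the Gaussian in the boundary term cancels against that of the integral
  term. In particular a zero derivative stays zero for every c, on which the density proofs
  rest.\<close>

lemma wprim_DERIV:
  assumes F: "continuous_on UNIV F" and f: "(F has_real_derivative f) (at x)"
  shows "(wprim c F has_real_derivative f * gauss c x) (at x)"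
proof -
  define I where "I x = oint 0 x (\<lambda>\<xi>. F \<xi> * \<xi> * gauss c \<xi>)" for x
  have "(I has_real_derivative F x * x * gauss c x) (at x)"
    unfolding I_def by (rule oint_DERIV[OF continuous_wprim_integrand[OF F]])
  moreover have "wprim c F = (\<lambda>x. F x * gauss c x + 2 * c * I x)"
    by (simp add: wprim_def I_def fun_eq_iff)
  ultimately show ?thesis
    by (auto intro!: derivative_eq_intros f gauss_DERIV simp: algebra_simps)
qed

section \<open>Multiplication of distributions by Gaussians\<close>

text \<open>This is \<open>mulw\<close> with an arbitrary real parameter, so that division by the
  weight is an instance as well.\<close>

definition gmul :: "real \<Rightarrow> ((real \<Rightarrow> real) \<Rightarrow> real) \<Rightarrow> ((real \<Rightarrow> real) \<Rightarrow> real)" where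
  "gmul c T = (\<lambda>\<phi>. if test_fun \<phi> then T (\<lambda>x. gauss c x * \<phi> x) else 0)"

lemma omega_gauss: "omega \<tau> = gauss (1 / (4 * \<tau>))"
  by (simp add: omega_def gauss_def fun_eq_iff)

lemma mulw_gmul: "mulw \<tau> = gmul (1 / (4 * \<tau>))"
  by (simp add: mulw_def gmul_def fun_eq_iff omega_gauss)

lemma gmul_gmul: "gmul a (gmul b T) = gmul (a + b) T"
  by (auto simp: gmul_def fun_eq_iff test_fun_mult[OF smooth_gauss] gauss_add mult.assoc mult.left_commute)

text \<open>The product rule for the Gaussian times \<phi> leaves one term in \<phi> itself; moving
  it back onto the derivative of \<phi> by parts produces exactly the integral term of
  \<open>wprim\<close>.\<close>

lemma gmul_dderiv:
  assumes F: "continuous_on UNIV F"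
  shows "gmul c (dderiv F) = dderiv (wprim c F)"
proof
  fix \<phi>
  show "gmul c (dderiv F) \<phi> = dderiv (wprim c F) \<phi>"
  proof (cases "test_fun \<phi>")
    case True
    define J where "J x = 2 * c * oint 0 x (\<lambda>\<xi>. F \<xi> * \<xi> * gauss c \<xi>)" for x
    have J': "(J has_real_derivative 2 * c * (F x * x * gauss c x)) (at x)" for x
      unfolding J_def by (auto intro!: derivative_eq_intros oint_DERIV[OF continuous_wprim_integrand[OF F]])
    have JC: "continuous_on UNIV J"
      unfolding J_def by (intro continuous_intros oint_continuous_on F)
    have J'C: "continuous_on UNIV (\<lambda>x. 2 * c * (F x * x * gauss c x))"
      by (intro continuous_intros F)
    have FC: "continuous_on UNIV (\<lambda>x. F x * gauss c x)"
      by (intro continuous_intros F)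
    have d\<phi>: "(\<phi> has_real_derivative deriv \<phi> x) (at x)" for x
      using True by (simp add: test_fun_iff smooth_DERIV)
    have "deriv (\<lambda>x. gauss c x * \<phi> x) = (\<lambda>x. gauss c x * deriv \<phi> x - 2 * c * x * gauss c x * \<phi> x)"
      by (rule ext, rule DERIV_imp_deriv)
         (auto intro!: derivative_eq_intros gauss_DERIV d\<phi> simp: algebra_simps)
    then have "(\<lambda>x. F x * deriv (\<lambda>x. gauss c x * \<phi> x) x) =
        (\<lambda>x. (F x * gauss c x) * deriv \<phi> x - (2 * c * (F x * x * gauss c x)) * \<phi> x)"
      by (simp add: algebra_simps)
    then have "gmul c (dderiv F) \<phi> =
        - integral UNIV (\<lambda>x. (F x * gauss c x) * deriv \<phi> x - (2 * c * (F x * x * gauss c x)) * \<phi> x)"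
      using True by (simp add: gmul_def dderiv_def test_fun_mult[OF smooth_gauss])
    also have "\<dots> = - (integral UNIV (\<lambda>x. (F x * gauss c x) * deriv \<phi> x)
        - integral UNIV (\<lambda>x. (2 * c * (F x * x * gauss c x)) * \<phi> x))"
      by (subst Henstock_Kurzweil_Integration.integral_diff)
         (intro integrable_continuous_test FC J'C True test_fun_deriv refl)+
    also have "\<dots> = - (integral UNIV (\<lambda>x. (F x * gauss c x) * deriv \<phi> x)
        + integral UNIV (\<lambda>x. J x * deriv \<phi> x))"
      using integral_parts_test[OF J' J'C True] by simp
    also have "\<dots> = - integral UNIV (\<lambda>x. (F x * gauss c x) * deriv \<phi> x + J x * deriv \<phi> x)"
      by (subst Henstock_Kurzweil_Integration.integral_add)
         (intro integrable_continuous_test FC JC True test_fun_deriv refl)+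
    also have "\<dots> = dderiv (wprim c F) \<phi>"
      using True by (simp add: dderiv_def wprim_def J_def algebra_simps)
    finally show ?thesis .
  qed (simp add: gmul_def dderiv_def)
qed

section \<open>Functions with limits at both ends\<close>

text \<open>\<open>Bc\<close> without its normalisation at minus infinity. Since
  \<open>wprim\<close> controls the value at 0 and not the limit at minus infinity, this larger
  space is the convenient one to work in.\<close>

definition Cends :: "(real \<Rightarrow> real) set" where
  "Cends = {G. continuous_on UNIV G \<and> (\<exists>l. (G \<longlongrightarrow> l) at_top) \<and> (\<exists>l. (G \<longlongrightarrow> l) at_bot)}"

lemma Cends_continuous: "G \<in> Cends \<Longrightarrow> continuous_on UNIV G"
  by (simp add: Cends_def)

lemma Cends_const: "(\<lambda>x. k) \<in> Cends"
  by (auto simp: Cends_def intro: tendsto_const)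

lemma Cends_add: "F \<in> Cends \<Longrightarrow> G \<in> Cends \<Longrightarrow> (\<lambda>x. F x + G x) \<in> Cends"
  by (auto simp: Cends_def intro!: exI intro: continuous_on_add tendsto_add)

lemma Cends_cmult: "F \<in> Cends \<Longrightarrow> (\<lambda>x. k * F x) \<in> Cends"
  by (auto simp: Cends_def intro!: exI intro: continuous_on_mult_left tendsto_mult_left)

lemma Cends_diff: "F \<in> Cends \<Longrightarrow> G \<in> Cends \<Longrightarrow> (\<lambda>x. F x - G x) \<in> Cends"
  by (auto simp: Cends_def intro!: exI intro: continuous_on_diff tendsto_diff)

lemma Cends_bounded:
  assumes "G \<in> Cends"
  shows "\<exists>B. \<forall>x. \<bar>G x\<bar> \<le> B"
proof -
  obtain l m where l: "(G \<longlongrightarrow> l) at_top" and m: "(G \<longlongrightarrow> m) at_bot"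
    using assms by (auto simp: Cends_def)
  obtain u where u: "\<And>x. x \<ge> u \<Longrightarrow> \<bar>G x - l\<bar> < 1"
    using tendstoD[OF l, of 1] by (auto simp: eventually_at_top_linorder dist_real_def)
  obtain v where v: "\<And>x. x \<le> v \<Longrightarrow> \<bar>G x - m\<bar> < 1"
    using tendstoD[OF m, of 1] by (auto simp: eventually_at_bot_linorder dist_real_def)
  have "compact (G ` {v..u})"
    using assms by (intro compact_continuous_image) (auto simp: Cends_def intro: continuous_on_subset)
  then obtain B where B: "\<And>x. x \<in> {v..u} \<Longrightarrow> \<bar>G x\<bar> \<le> B"
    by (metis bounded_real compact_imp_bounded imageI)
  have "\<bar>G x\<bar> \<le> \<bar>B\<bar> + \<bar>l\<bar> + \<bar>m\<bar> + 1" for x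
  proof -
    consider "x \<ge> u" | "x \<le> v" | "x \<in> {v..u}" by fastforce
    then show ?thesis
    proof cases
      case 1 then show ?thesis using u[OF 1] by linarith
    next
      case 2 then show ?thesis using v[OF 2] by linarith
    next
      case 3 then show ?thesis using B[OF 3] by linarith
    qed
  qed
  then show ?thesis by blast
qed

lemma bnorm_le:
  assumes "\<And>x y. \<bar>G x - G y\<bar> \<le> B"
  shows "bnorm G \<le> B"
  unfolding bnorm_def
proof (rule cSup_least)
  show "{\<bar>G x - G y\<bar> |x y. x < y} \<noteq> {}"
    using lt_ex by blast
qed (use assms in auto)

text \<open>Functions in \<open>Cends\<close> are bounded, so the supremum in \<open>bnorm\<close>
  is taken over a bounded set and is a true upper bound.\<close>

lemma bnorm_ge:
  assumes "G \<in> Cends"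
  shows "\<bar>G x - G y\<bar> \<le> bnorm G"
proof -
  obtain B where B: "\<And>x. \<bar>G x\<bar> \<le> B" using Cends_bounded[OF assms] by blast
  have "\<bar>G x - G y\<bar> \<le> 2 * B" for x y
    using B[of x] B[of y] by linarith
  then have bdd: "bdd_above {\<bar>G x - G y\<bar> |x y. x < y}"
    by (auto intro!: bdd_aboveI)
  have *: "\<bar>G x - G y\<bar> \<le> bnorm G" if "x < y" for x y
    unfolding bnorm_def by (rule cSup_upper[OF _ bdd]) (use that in blast)
  have "bnorm G \<ge> 0" using *[of 0 1] by simp
  then show ?thesis
    using *[of x y] *[of y x] by (metis abs_minus_commute abs_zero cancel_comm_monoid_add_class.diff_cancel linorder_neqE)
qed

lemma bnorm_nonneg: "G \<in> Cends \<Longrightarrow> bnorm G \<ge> 0"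
  using bnorm_ge[of G 0 0] by simp

lemma bnorm_diff_const [simp]: "bnorm (\<lambda>x. G x - k) = bnorm G"
  by (simp add: bnorm_def)

section \<open>\<open>Bc\<close> and \<open>Ac\<close> as \<open>Cends\<close> modulo
  constants\<close>

lemma Bc_iff: "G \<in> Bc \<longleftrightarrow> G \<in> Cends \<and> (G \<longlongrightarrow> 0) at_bot"
  by (auto simp: Bc_def Cends_def)

lemma Cends_imp_Bc:
  assumes "G \<in> Cends"
  obtains k where "(\<lambda>x. G x - k) \<in> Bc"
proof -
  obtain m where m: "(G \<longlongrightarrow> m) at_bot"
    using assms by (auto simp: Cends_def)
  have "((\<lambda>x. G x - m) \<longlongrightarrow> m - m) at_bot"
    by (intro tendsto_diff m tendsto_const)
  then show thesis
    using that Cends_diff[OF assms Cends_const] by (simp add: Bc_iff)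
qed

lemma Bc_unique:
  assumes "G \<in> Bc" "H \<in> Bc" "\<And>x. G x - G 0 = H x - H 0"
  shows "G = H"
proof -
  have "((\<lambda>x. G x - H x) \<longlongrightarrow> 0 - 0) at_bot"
    using assms by (intro tendsto_diff) (auto simp: Bc_iff)
  moreover have "(\<lambda>x. G x - H x) = (\<lambda>x. G 0 - H 0)"
    using assms(3) by (auto simp: fun_eq_iff algebra_simps)
  ultimately have "G 0 - H 0 = 0"
    by (metis tendsto_const_iff trivial_limit_at_bot_linorder diff_zero)
  then show ?thesis using assms(3) by (auto simp: fun_eq_iff)
qed

lemma prim_dderiv:
  assumes "G \<in> Bc"
  shows "prim (dderiv G) = G"
  unfolding prim_def
proof (rule the_equality)
  fix H assume "H \<in> Bc \<and> dderiv G = dderiv H"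
  then show "H = G"
    using assms by (intro Bc_unique) (auto simp: Bc_iff Cends_def intro: dderiv_eqD)
qed (use assms in auto)

lemma Ac_iff: "f \<in> Ac \<longleftrightarrow> (\<exists>G\<in>Cends. f = dderiv G)"
proof
  assume "\<exists>G\<in>Cends. f = dderiv G"
  then obtain G where G: "G \<in> Cends" "f = dderiv G" by blast
  obtain k where "(\<lambda>x. G x - k) \<in> Bc" using Cends_imp_Bc[OF G(1)] .
  then have "dderiv (\<lambda>x. G x - k) \<in> Ac"
    unfolding Ac_def by blast
  then show "f \<in> Ac"
    using G by (simp add: dderiv_diff_const Cends_continuous)
qed (auto simp: Ac_def Bc_iff)

lemma alex_dderiv:
  assumes "G \<in> Cends"
  shows "alex (dderiv G) = bnorm G"
proof -
  obtain k where k: "(\<lambda>x. G x - k) \<in> Bc" using Cends_imp_Bc[OF assms] .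
  then show ?thesis
    using prim_dderiv[OF k] by (simp add: alex_def dderiv_diff_const Cends_continuous[OF assms])
qed

section \<open>The Volterra spaces in terms of weighted primitives\<close>

lemma volterra_iff: "volterra \<tau> G F \<longleftrightarrow> (\<forall>x. G x - G 0 = wprim (1 / (4 * \<tau>)) F x)"
  by (simp add: volterra_def wprim_def omega_gauss)

text \<open>The Volterra equation prescribes G - G(0), and the condition at minus infinity then
  fixes the constant; so a suitable G exists as soon as the weighted primitive has limits at both
  ends. Evaluating at x = 0 forces F 0 = 0.\<close>

lemma Bct_iff:
  "F \<in> Bct \<tau> \<longleftrightarrow> continuous_on UNIV F \<and> F 0 = 0 \<and> wprim (1 / (4 * \<tau>)) F \<in> Cends"
proof
  assume "F \<in> Bct \<tau>"
  then obtain G where G: "continuous_on UNIV F" "G \<in> Bc" "\<And>x. G x - G 0 = wprim (1 / (4 * \<tau>)) F x"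
    by (auto simp: Bct_def volterra_iff)
  have "F 0 = 0" using G(3)[of 0] by simp
  moreover have "wprim (1 / (4 * \<tau>)) F \<in> Cends"
    using Cends_diff[OF _ Cends_const, of G "G 0"] G(2,3) by (simp add: Bc_iff)
  ultimately show "continuous_on UNIV F \<and> F 0 = 0 \<and> wprim (1 / (4 * \<tau>)) F \<in> Cends"
    using G(1) by simp
next
  assume F: "continuous_on UNIV F \<and> F 0 = 0 \<and> wprim (1 / (4 * \<tau>)) F \<in> Cends"
  then obtain k where "(\<lambda>x. wprim (1 / (4 * \<tau>)) F x - k) \<in> Bc"
    using Cends_imp_Bc by blast
  then show "F \<in> Bct \<tau>"
    using F by (auto simp: Bct_def volterra_iff intro!: bexI[of _ "\<lambda>x. wprim (1 / (4 * \<tau>)) F x - k"])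
qed

lemma norm_Bct_eq:
  assumes "F \<in> Bct \<tau>"
  shows "norm_Bct \<tau> F = bnorm (wprim (1 / (4 * \<tau>)) F)"
proof -
  have F: "F 0 = 0" "wprim (1 / (4 * \<tau>)) F \<in> Cends" using assms by (auto simp: Bct_iff)
  obtain k where k: "(\<lambda>x. wprim (1 / (4 * \<tau>)) F x - k) \<in> Bc"
    using Cends_imp_Bc[OF F(2)] .
  have "(THE G. G \<in> Bc \<and> volterra \<tau> G F) = (\<lambda>x. wprim (1 / (4 * \<tau>)) F x - k)"
    using k F by (intro the_equality) (auto simp: volterra_iff intro: Bc_unique)
  then show ?thesis
    by (simp add: norm_Bct_def)
qed

lemma wprim_inverse:
  "continuous_on UNIV F \<Longrightarrow> wprim (- c) (wprim c F) = F"
  "continuous_on UNIV F \<Longrightarrow> wprim c (wprim (- c) F) = F"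
  by (simp_all add: wprim_wprim)

lemma prim_t_dderiv:
  assumes "F \<in> Bct \<tau>"
  shows "prim_t \<tau> (dderiv F) = F"
  unfolding prim_t_def
proof (rule the_equality)
  fix H assume H: "H \<in> Bct \<tau> \<and> dderiv F = dderiv H"
  show "H = F"
  proof
    show "H x = F x" for x
      using dderiv_eqD[of F H x 0] H assms by (auto simp: Bct_iff)
  qed
qed (use assms in auto)

lemma shift_in_Bct:
  assumes "continuous_on UNIV F" "wprim (1 / (4 * \<tau>)) F \<in> Cends"
  shows "(\<lambda>x. F x - F 0) \<in> Bct \<tau>"
  using assms Cends_diff[OF assms(2) Cends_const] 
  by (simp add: Bct_iff wprim_diff continuous_on_diff)

lemma Act_iff:
  "f \<in> Act \<tau> \<longleftrightarrow> (\<exists>F. continuous_on UNIV F \<and> wprim (1 / (4 * \<tau>)) F \<in> Cends \<and> f = dderiv F)"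
proof
  assume "\<exists>F. continuous_on UNIV F \<and> wprim (1 / (4 * \<tau>)) F \<in> Cends \<and> f = dderiv F"
  then obtain F where F: "continuous_on UNIV F" "wprim (1 / (4 * \<tau>)) F \<in> Cends" "f = dderiv F" by blast
  have "dderiv (\<lambda>x. F x - F 0) \<in> Act \<tau>"
    unfolding Act_def using shift_in_Bct[OF F(1,2)] by blast
  then show "f \<in> Act \<tau>"
    using F by (simp add: dderiv_diff_const)
qed (auto simp: Act_def Bct_iff)

lemma norm_Act_dderiv:
  assumes "continuous_on UNIV F" "wprim (1 / (4 * \<tau>)) F \<in> Cends"
  shows "norm_Act \<tau> (dderiv F) = bnorm (wprim (1 / (4 * \<tau>)) F)"
proof -
  have "norm_Act \<tau> (dderiv F) = norm_Act \<tau> (dderiv (\<lambda>x. F x - F 0))"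
    using dderiv_diff_const[OF assms(1)] by simp
  also have "\<dots> = bnorm (wprim (1 / (4 * \<tau>)) (\<lambda>x. F x - F 0))"
    by (simp add: norm_Act_def prim_t_dderiv norm_Bct_eq shift_in_Bct[OF assms])
  finally show ?thesis
    by (simp add: wprim_diff assms)
qed

section \<open>Bounds and limits of weighted primitives\<close>

lemma oint_reflect: "oint 0 (- x) h = - oint 0 x (\<lambda>\<xi>. h (- \<xi>))"
  using Henstock_Kurzweil_Integration.integral_reflect_real[of 0 "- x" h]
    Henstock_Kurzweil_Integration.integral_reflect_real[of "- x" 0 h]
  by (auto simp: oint_def)

text \<open>The weight is even, so every assertion at minus infinity reduces to one at plus
  infinity.\<close>

lemma wprim_reflect: "wprim c (\<lambda>x. F (- x)) = (\<lambda>x. wprim c F (- x))"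
proof
  fix x
  have "oint 0 x (\<lambda>\<xi>. F (- \<xi>) * \<xi> * gauss c \<xi>) = oint 0 (- x) (\<lambda>\<xi>. F \<xi> * \<xi> * gauss c \<xi>)"
    unfolding oint_reflect[of x] using oint_cmult[of x "-1" "\<lambda>\<xi>. F (- \<xi>) * (- \<xi>) * gauss c (- \<xi>)"]
    by (simp add: gauss_def)
  then show "wprim c (\<lambda>x. F (- x)) x = wprim c F (- x)"
    by (simp add: wprim_def gauss_def)
qed

lemma monotone_bounded_tendsto_at_top:
  fixes f :: "real \<Rightarrow> real"
  assumes "\<And>x y. 0 \<le> x \<Longrightarrow> x \<le> y \<Longrightarrow> f x \<le> f y" and "\<And>x. 0 \<le> x \<Longrightarrow> f x \<le> B"
  shows "\<exists>l. (f \<longlongrightarrow> l) at_top"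
proof (intro exI increasing_tendsto)
  have bdd: "bdd_above (f ` {0..})"
    using assms(2) by (auto intro!: bdd_aboveI)
  show "\<forall>\<^sub>F x in at_top. f x \<le> (SUP x\<in>{0..}. f x)"
    by (rule eventually_at_top_linorderI[of 0]) (auto intro: cSUP_upper[OF _ bdd])
  fix y assume "y < (SUP x\<in>{0..}. f x)"
  then obtain x where "x \<ge> 0" "y < f x"
    using less_cSUP_iff[OF _ bdd] by auto
  then show "\<forall>\<^sub>F x in at_top. y < f x"
    using assms(1) by (intro eventually_at_top_linorderI[of x]) (meson order_less_le_trans)
qed

lemma oint_nondecreasing:
  assumes "\<And>a b. k integrable_on {a..b}" "\<And>x. x \<ge> 0 \<Longrightarrow> k x \<ge> 0" "0 \<le> x" "x \<le> y"
  shows "oint 0 x k \<le> oint 0 y k"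
proof -
  have "integral {x..y} k \<ge> 0"
    using assms by (intro Henstock_Kurzweil_Integration.integral_nonneg) auto
  then show ?thesis using oint_diff[OF assms(1,4)] by simp
qed

text \<open>Comparison test for improper integrals. Both k and k + h are nonnegative with bounded
  integrals, so their integrals converge monotonically, and h is the difference.\<close>

lemma oint_dominated_at_top:
  assumes h: "\<And>a b. h integrable_on {a..b}" and k: "\<And>a b. k integrable_on {a..b}"
    and hk: "\<And>x. x \<ge> 0 \<Longrightarrow> \<bar>h x\<bar> \<le> k x" and B: "\<And>x. x \<ge> 0 \<Longrightarrow> oint 0 x k \<le> B"
  shows "\<exists>l. ((\<lambda>x. oint 0 x h) \<longlongrightarrow> l) at_top"
proof -
  define p where "p x = k x + h x" for x
  have p: "p integrable_on {a..b}" for a b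
    unfolding p_def by (intro Henstock_Kurzweil_Integration.integrable_add h k)
  have po: "oint 0 x p = oint 0 x k + oint 0 x h" for x
    unfolding p_def[abs_def] by (rule oint_add[OF k h])
  have p_le: "oint 0 x p \<le> 2 * B" if "x \<ge> 0" for x
  proof -
    have "integral {0..x} h \<le> integral {0..x} k"
      by (rule integral_le[OF h k]) (use hk in \<open>force simp: abs_le_iff\<close>)
    then show ?thesis using B[OF that] that by (simp add: po) (simp add: oint_def)
  qed
  have p_mono: "oint 0 x p \<le> oint 0 y p" if "0 \<le> x" "x \<le> y" for x y
  proof (rule oint_nondecreasing[OF p _ that])
    show "p t \<ge> 0" if "t \<ge> 0" for t
      using hk[OF that] by (simp add: p_def)
  qed
  have k_mono: "oint 0 x k \<le> oint 0 y k" if "0 \<le> x" "x \<le> y" for x y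
  proof (rule oint_nondecreasing[OF k _ that])
    show "k t \<ge> 0" if "t \<ge> 0" for t
      using hk[OF that] by simp
  qed
  obtain l where l: "((\<lambda>x. oint 0 x p) \<longlongrightarrow> l) at_top"
    using monotone_bounded_tendsto_at_top[of "\<lambda>x. oint 0 x p", OF p_mono p_le] by blast
  obtain m where m: "((\<lambda>x. oint 0 x k) \<longlongrightarrow> m) at_top"
    using monotone_bounded_tendsto_at_top[of "\<lambda>x. oint 0 x k", OF k_mono B] by blast
  have "((\<lambda>x. oint 0 x p - oint 0 x k) \<longlongrightarrow> l - m) at_top"
    by (intro tendsto_diff l m)
  then show ?thesis by (auto simp: po)
qed

lemma tendsto_at_bot_reflect:
  fixes f :: "real \<Rightarrow> real"
  shows "((\<lambda>x. f (- x)) \<longlongrightarrow> l) at_top \<longleftrightarrow> (f \<longlongrightarrow> l) at_bot"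
  by (simp add: at_bot_mirror filterlim_filtermap)

lemma Cends_reflect:
  assumes "G \<in> Cends"
  shows "(\<lambda>x. G (- x)) \<in> Cends"
proof -
  obtain l m where "(G \<longlongrightarrow> l) at_top" "(G \<longlongrightarrow> m) at_bot"
    using assms by (auto simp: Cends_def)
  then have "((\<lambda>x. G (- x)) \<longlongrightarrow> l) at_bot" "((\<lambda>x. G (- x)) \<longlongrightarrow> m) at_top"
    by (simp_all add: filterlim_compose filterlim_uminus_at_top_at_bot filterlim_uminus_at_bot_at_top)
  moreover have "continuous_on UNIV (\<lambda>x. G (- x))"
    by (rule continuous_on_compose2[OF Cends_continuous[OF assms]]) (auto intro!: continuous_intros)
  ultimately show ?thesis by (auto simp: Cends_def)
qed

lemma oint_dominated:
  assumes h: "\<And>a b. h integrable_on {a..b}" and k: "\<And>a b. k integrable_on {a..b}"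
    and hk: "\<And>x. \<bar>h x\<bar> \<le> k \<bar>x\<bar>" and B: "\<And>x. x \<ge> 0 \<Longrightarrow> oint 0 x k \<le> B"
  shows "\<exists>l. ((\<lambda>x. oint 0 x h) \<longlongrightarrow> l) at_top" "\<exists>l. ((\<lambda>x. oint 0 x h) \<longlongrightarrow> l) at_bot"
proof -
  show "\<exists>l. ((\<lambda>x. oint 0 x h) \<longlongrightarrow> l) at_top"
  proof (rule oint_dominated_at_top[OF h k _ B])
    show "\<bar>h x\<bar> \<le> k x" if "x \<ge> 0" for x using hk[of x] that by simp
  qed
  have h': "(\<lambda>x. h (- x)) integrable_on {a..b}" for a b
    using h[of "-b" "-a"] Henstock_Kurzweil_Integration.integrable_reflect_real[of h "-a" "-b"] by simp
  have "\<exists>l. ((\<lambda>x. oint 0 x (\<lambda>\<xi>. h (- \<xi>))) \<longlongrightarrow> l) at_top"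
  proof (rule oint_dominated_at_top[OF h' k _ B])
    show "\<bar>h (- x)\<bar> \<le> k x" if "x \<ge> 0" for x using hk[of "- x"] that by simp
  qed
  then obtain l where "((\<lambda>x. oint 0 x (\<lambda>\<xi>. h (- \<xi>))) \<longlongrightarrow> l) at_top" ..
  then have "((\<lambda>x. oint 0 (- x) h) \<longlongrightarrow> - l) at_top"
    unfolding oint_reflect by (rule tendsto_minus)
  then show "\<exists>l. ((\<lambda>x. oint 0 x h) \<longlongrightarrow> l) at_bot"
    using tendsto_at_bot_reflect[of "\<lambda>x. oint 0 x h"] by blast
qed

text \<open>The invariance of constants under \<open>wprim\<close>, read as a closed form of the
  integral; it stays valid for c = 0.\<close>

lemma oint_gauss: "2 * c * oint 0 x (\<lambda>\<xi>. k * \<xi> * gauss c \<xi>) = k * (1 - gauss c x)"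
  using fun_cong[OF wprim_const[of c k], of x] 
  unfolding wprim_def right_diff_distrib by linarith

text \<open>For c > 0 the boundary term dies out at both ends, and the integral converges by
  comparison with B |x| exp (- c x^2), whose integral is elementary.\<close>

lemma Cends_wprim:
  assumes G: "G \<in> Cends" and c: "c \<ge> 0"
  shows "wprim c G \<in> Cends"
proof (cases "c = 0")
  case False
  then have c: "c > 0" using c by simp
  obtain B where B: "\<And>x. \<bar>G x\<bar> \<le> B" using Cends_bounded[OF G] by blast
  have GC: "continuous_on UNIV G" by (rule Cends_continuous[OF G])
  have "oint 0 x (\<lambda>\<xi>. B * \<xi> * gauss c \<xi>) \<le> B / (2 * c)" for x
  proof -
    have "2 * c * oint 0 x (\<lambda>\<xi>. B * \<xi> * gauss c \<xi>) \<le> B * 1"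
      unfolding oint_gauss using B[of 0] by (intro mult_left_mono) auto
    then show ?thesis using c by (simp add: field_simps)
  qed
  moreover have "\<bar>G x * x * gauss c x\<bar> \<le> B * \<bar>x\<bar> * gauss c \<bar>x\<bar>" for x
    using B[of x] by (auto simp: abs_mult gauss_def intro!: mult_right_mono)
  ultimately have lims: "\<exists>l. ((\<lambda>x. oint 0 x (\<lambda>\<xi>. G \<xi> * \<xi> * gauss c \<xi>)) \<longlongrightarrow> l) at_top"
      "\<exists>l. ((\<lambda>x. oint 0 x (\<lambda>\<xi>. G \<xi> * \<xi> * gauss c \<xi>)) \<longlongrightarrow> l) at_bot"
    using oint_dominated[OF continuous_integrable_Icc[OF continuous_wprim_integrand[OF GC]]
        continuous_integrable_Icc[OF continuous_wprim_integrand[OF continuous_on_const]]] by blast+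
  have "(gauss c \<longlongrightarrow> 0) at_top" "(gauss c \<longlongrightarrow> 0) at_bot"
    using c unfolding gauss_def[abs_def] by real_asymp+
  moreover obtain l m where "(G \<longlongrightarrow> l) at_top" "(G \<longlongrightarrow> m) at_bot"
    using G by (auto simp: Cends_def)
  moreover obtain p q where "((\<lambda>x. oint 0 x (\<lambda>\<xi>. G \<xi> * \<xi> * gauss c \<xi>)) \<longlongrightarrow> p) at_top"
      "((\<lambda>x. oint 0 x (\<lambda>\<xi>. G \<xi> * \<xi> * gauss c \<xi>)) \<longlongrightarrow> q) at_bot"
    using lims by blast
  ultimately have "(wprim c G \<longlongrightarrow> l * 0 + 2 * c * p) at_top \<and> (wprim c G \<longlongrightarrow> m * 0 + 2 * c * q) at_bot"
    unfolding wprim_def[abs_def] by (intro conjI tendsto_add tendsto_mult tendsto_const)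
  then show ?thesis
    using wprim_continuous[OF GC] by (auto simp: Cends_def)
qed (use G in simp)

lemma wprim_Cends_mono:
  assumes "continuous_on UNIV F" "wprim a F \<in> Cends" "a \<le> b"
  shows "wprim b F \<in> Cends"
  using Cends_wprim[OF assms(2), of "b - a"] assms by (simp add: wprim_wprim)

section \<open>Pointwise bounds and growth\<close>

text \<open>For the constant H = N there is equality by \<open>oint_gauss\<close>, and a general H
  is compared with it. The comparison function \<Phi> has derivative x times a nonnegative factor,
  so it is smallest at 0; this treats both signs of x together.\<close>

lemma oint_gauss_bound:
  assumes H: "continuous_on UNIV H" and N: "\<And>x. \<bar>H x\<bar> \<le> N"
  shows "\<bar>2 * c * oint 0 x (\<lambda>\<xi>. H \<xi> * \<xi> * gauss c \<xi>)\<bar> \<le> N * \<bar>1 - gauss c x\<bar>"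
proof -
  define I where "I x = oint 0 x (\<lambda>\<xi>. H \<xi> * \<xi> * gauss c \<xi>)" for x
  have I': "(I has_real_derivative H x * x * gauss c x) (at x)" for x
    unfolding I_def by (rule oint_DERIV[OF continuous_wprim_integrand[OF H]])
  \<comment> \<open>The sign for which \<sigma> * (1 - \<open>gauss c x\<close>) is the absolute
    value; s = 1 and s = -1 then yield the two one-sided bounds.\<close>
  define \<sigma> :: real where "\<sigma> = (if c \<ge> 0 then 1 else -1)"
  have bound: "s * (2 * c * I x) \<le> N * \<sigma> * (1 - gauss c x)" if s: "\<bar>s\<bar> = 1" for s
  proof -
    define \<Phi> where "\<Phi> x = N * \<sigma> * (1 - gauss c x) - s * (2 * c * I x)" for x
    define d where "d x = 2 * gauss c x * (\<sigma> * c * N - s * c * H x)" for x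
    have \<Phi>': "(\<Phi> has_real_derivative d x * x) (at x)" for x
      unfolding \<Phi>_def d_def by (auto intro!: derivative_eq_intros I' gauss_DERIV simp: algebra_simps)
    have d: "d x \<ge> 0" for x
    proof -
      have "s * c * H x \<le> \<bar>c\<bar> * \<bar>H x\<bar>"
        using s by (metis abs_ge_self abs_mult mult_1)
      also have "\<dots> \<le> \<bar>c\<bar> * N" by (intro mult_left_mono N) auto
      also have "\<dots> = \<sigma> * c * N" by (auto simp: \<sigma>_def)
      finally show ?thesis by (simp add: d_def)
    qed
    have "\<Phi> 0 \<le> \<Phi> x"
    proof (cases "x \<ge> 0")
      case True
      show ?thesis
      proof (rule DERIV_nonneg_imp_nondecreasing[OF True])
        show "\<exists>y. (\<Phi> has_real_derivative y) (at t) \<and> 0 \<le> y" if "0 \<le> t" for t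
          using \<Phi>'[of t] mult_nonneg_nonneg[OF d[of t] that] by blast
      qed
    next
      case False
      then have "x \<le> 0" by simp
      then show ?thesis
      proof (rule DERIV_nonpos_imp_nonincreasing)
        show "\<exists>y. (\<Phi> has_real_derivative y) (at t) \<and> y \<le> 0" if "t \<le> 0" for t
          using \<Phi>'[of t] mult_nonneg_nonpos[OF d[of t] that] by blast
      qed
    qed
    then show ?thesis by (simp add: \<Phi>_def I_def)
  qed
  have "N * \<sigma> * (1 - gauss c x) \<le> N * \<bar>1 - gauss c x\<bar>"
    using N[of 0] by (auto simp: \<sigma>_def mult.assoc intro!: mult_left_mono)
  then show ?thesis
    using bound[of 1] bound[of "-1"] by (simp add: I_def)
qed

lemma gauss_le_1: "c \<ge> 0 \<Longrightarrow> gauss c x \<le> 1" and gauss_ge_1: "c \<le> 0 \<Longrightarrow> gauss c x \<ge> 1"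
  by (auto simp: gauss_def mult_nonpos_nonneg)

text \<open>After subtracting G 0 the boundary term is bounded with weight \<open>gauss c x\<close>
  and the integral with weight 1 - \<open>gauss c x\<close>; for c \<ge> 0 these are nonnegative and
  add up to 1.\<close>

lemma wprim_bound_contract:
  assumes G: "continuous_on UNIV G" and N: "\<And>x. \<bar>G x - G 0\<bar> \<le> N" and c: "c \<ge> 0"
  shows "\<bar>wprim c G x - G 0\<bar> \<le> N"
proof -
  define H where "H x = G x - G 0" for x
  have HC: "continuous_on UNIV H" unfolding H_def by (intro continuous_intros G)
  have "\<bar>2 * c * oint 0 x (\<lambda>\<xi>. H \<xi> * \<xi> * gauss c \<xi>)\<bar> \<le> N * \<bar>1 - gauss c x\<bar>"
    by (rule oint_gauss_bound[OF HC]) (use N in \<open>simp add: H_def\<close>)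
  moreover have "\<bar>H x * gauss c x\<bar> \<le> N * gauss c x"
    using N[of x] by (simp add: H_def abs_mult mult_right_mono)
  ultimately have "\<bar>wprim c H x\<bar> \<le> N * gauss c x + N * (1 - gauss c x)"
    unfolding wprim_def using gauss_le_1[OF c, of x] by simp
  moreover have "wprim c H x = wprim c G x - G 0"
    unfolding H_def[abs_def] by (simp add: wprim_diff G)
  ultimately show ?thesis by (simp add: algebra_simps)
qed

text \<open>Subtracting G x instead of G 0 kills the boundary term. Centring at G 0 would give N (2
  \<open>gauss c x\<close> - 1), which is too weak for the constant 1 in the growth bound.\<close>

lemma wprim_bound_expand:
  assumes G: "continuous_on UNIV G" and N: "\<And>x y. \<bar>G x - G y\<bar> \<le> N" and c: "c \<le> 0"
  shows "\<bar>wprim c G x - G 0\<bar> \<le> N * gauss c x"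
proof -
  define H where "H y = G y - G x" for y
  have HC: "continuous_on UNIV H" unfolding H_def by (intro continuous_intros G)
  have "\<bar>2 * c * oint 0 x (\<lambda>\<xi>. H \<xi> * \<xi> * gauss c \<xi>)\<bar> \<le> N * \<bar>1 - gauss c x\<bar>"
    by (rule oint_gauss_bound[OF HC]) (use N in \<open>simp add: H_def\<close>)
  then have "\<bar>wprim c H x\<bar> \<le> N * (gauss c x - 1)"
    unfolding wprim_def using gauss_ge_1[OF c, of x] by (simp add: H_def)
  moreover have "wprim c H x = wprim c G x - G x"
    unfolding H_def[abs_def] by (simp add: wprim_diff G)
  ultimately show ?thesis using N[of x 0] by (simp add: algebra_simps)
qed

text \<open>By l'Hospital the integral divided by exp (c x^2) tends to l / (2 c), so after
  multiplication by the weight the two terms of \<open>wprim\<close> have opposite limits l and -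
  l.\<close>

lemma wprim_growth_at_top:
  assumes G: "continuous_on UNIV G" and l: "(G \<longlongrightarrow> l) at_top" and c: "c > 0"
  shows "((\<lambda>x. wprim (- c) G x * gauss c x) \<longlongrightarrow> 0) at_top"
proof -
  define I where "I x = oint 0 x (\<lambda>\<xi>. G \<xi> * \<xi> * gauss (- c) \<xi>)" for x
  have I': "(I has_real_derivative G x * x * gauss (- c) x) (at x)" for x
    unfolding I_def by (rule oint_DERIV[OF continuous_wprim_integrand[OF G]])
  have "((\<lambda>x. I x / gauss (- c) x) \<longlongrightarrow> l / (2 * c)) at_top"
  proof (rule lhospital_at_top_at_top)
    show "LIM x at_top. gauss (- c) x :> at_top"
      using c unfolding gauss_def by real_asymp
    show "\<forall>\<^sub>F x in at_top. 2 * c * x * gauss (- c) x \<noteq> 0"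
      by (rule eventually_mono[OF eventually_gt_at_top[of 0]]) (use c in simp)
    show "\<forall>\<^sub>F x in at_top. (I has_real_derivative G x * x * gauss (- c) x) (at x)"
      using I' by simp
    show "\<forall>\<^sub>F x in at_top. (gauss (- c) has_real_derivative 2 * c * x * gauss (- c) x) (at x)"
      using gauss_DERIV[of "- c"] by simp
    have "((\<lambda>x. G x / (2 * c)) \<longlongrightarrow> l / (2 * c)) at_top"
      using c by (intro tendsto_intros l) auto
    then show "((\<lambda>x. G x * x * gauss (- c) x / (2 * c * x * gauss (- c) x)) \<longlongrightarrow> l / (2 * c)) at_top"
      by (rule Lim_transform_eventually)
         (rule eventually_mono[OF eventually_gt_at_top[of 0]], use c in simp)
  qed
  then have "((\<lambda>x. G x - 2 * c * (I x / gauss (- c) x)) \<longlongrightarrow> l - 2 * c * (l / (2 * c))) at_top"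
    by (intro tendsto_diff tendsto_mult tendsto_const l)
  moreover have "wprim (- c) G x * gauss c x = G x - 2 * c * (I x / gauss (- c) x)" for x
  proof -
    have "gauss c x = 1 / gauss (- c) x"
      using gauss_add[of c "- c" x] by (simp add: field_simps)
    then show ?thesis
      by (simp add: wprim_def I_def field_simps)
  qed
  ultimately show ?thesis using c by simp
qed

lemma wprim_growth:
  assumes F: "continuous_on UNIV F" and G: "wprim c F \<in> Cends" and c: "c > 0"
  shows "((\<lambda>x. F x * gauss c x) \<longlongrightarrow> 0) at_infinity"
proof -
  have top: "((\<lambda>x. F x * gauss c x) \<longlongrightarrow> 0) at_top"
    if F: "continuous_on UNIV F" and G: "wprim c F \<in> Cends" for F
    using wprim_growth_at_top[OF Cends_continuous[OF G] _ c] G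
    by (auto simp: wprim_inverse[OF F] Cends_def)
  have "((\<lambda>x. F (- x) * gauss c x) \<longlongrightarrow> 0) at_top"
    using F Cends_reflect[OF G]
    by (intro top) (auto simp: wprim_reflect intro!: continuous_on_compose2[of UNIV F] continuous_intros)
  then have "((\<lambda>x. F x * gauss c x) \<longlongrightarrow> 0) at_bot"
    by (simp add: tendsto_at_bot_reflect[symmetric] gauss_def)
  then show ?thesis
    using top[OF F G] by (simp add: at_infinity_eq_at_top_bot filterlim_sup)
qed

section \<open>Witnesses for strict inclusions\<close>

lemma wprim_gauss:
  assumes "a \<noteq> d"
  shows "wprim a (gauss (- d)) = (\<lambda>x. d / (d - a) * gauss (a - d) x - a / (d - a))"
proof
  fix x
  have "(\<lambda>\<xi>. gauss (- d) \<xi> * \<xi> * gauss a \<xi>) = (\<lambda>\<xi>. 1 * \<xi> * gauss (a - d) \<xi>)"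
    using gauss_add[of a "- d"] by (simp add: fun_eq_iff)
  then have "2 * (a - d) * oint 0 x (\<lambda>\<xi>. gauss (- d) \<xi> * \<xi> * gauss a \<xi>) = 1 - gauss (a - d) x"
    using oint_gauss[of "a - d" x 1] by simp
  then have o: "oint 0 x (\<lambda>\<xi>. gauss (- d) \<xi> * \<xi> * gauss a \<xi>) = (1 - gauss (a - d) x) / (2 * (a - d))"
    using assms by (simp add: field_simps)
  have "wprim a (gauss (- d)) x = gauss (a - d) x + 2 * a * ((1 - gauss (a - d) x) / (2 * (a - d)))"
    unfolding wprim_def o using gauss_add[of a "- d" x] by simp
  also have "\<dots> = d / (d - a) * gauss (a - d) x - a / (d - a)"
  proof -
    define u where "u = d - a"
    have "u \<noteq> 0" "d = a + u" using assms by (auto simp: u_def)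
    then show ?thesis by (simp add: field_simps)
  qed
  finally show "wprim a (gauss (- d)) x = d / (d - a) * gauss (a - d) x - a / (d - a)" .
qed

text \<open>A primitive growing like exp (d x^2) is tamed by exp (- b x^2) but not by exp (- a x^2)
  when a < d < b. The case a = 0 separates \<open>Ac\<close> from the weighted spaces.\<close>

lemma wprim_gauss_Cends:
  assumes "0 \<le> a" "a < d" "d < b"
  shows "wprim b (gauss (- d)) \<in> Cends" "wprim a (gauss (- d)) \<notin> Cends"
proof -
  have "(gauss (b - d) \<longlongrightarrow> 0) at_top" "(gauss (b - d) \<longlongrightarrow> 0) at_bot"
    using assms unfolding gauss_def[abs_def] by real_asymp+
  then have "gauss (b - d) \<in> Cends"
    by (auto simp: Cends_def intro!: continuous_intros)
  then show "wprim b (gauss (- d)) \<in> Cends"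
    using Cends_diff[OF Cends_cmult[of "gauss (b - d)" "d / (d - b)"] Cends_const] assms
    by (simp only: wprim_gauss)
  have "filterlim (\<lambda>x. d / (d - a) * gauss (a - d) x - a / (d - a)) at_top at_top"
    using assms unfolding gauss_def[abs_def] by real_asymp
  then have "filterlim (wprim a (gauss (- d))) at_top at_top"
    using assms by (simp add: wprim_gauss)
  then show "wprim a (gauss (- d)) \<notin> Cends"
    unfolding Cends_def
    using not_tendsto_and_filterlim_at_infinity[OF trivial_limit_at_top_linorder _
        filterlim_at_top_imp_at_infinity] by blast
qed

section \<open>Functions that are constant near both ends\<close>

definition clip :: "real \<Rightarrow> (real \<Rightarrow> real) \<Rightarrow> real \<Rightarrow> real" where
  "clip M G x = G (max (- M) (min M x))"

lemma continuous_clip: "continuous_on UNIV G \<Longrightarrow> continuous_on UNIV (clip M G)"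
  unfolding clip_def[abs_def]
  by (rule continuous_on_compose2[of UNIV G]) (auto intro!: continuous_intros)

lemma DERIV_zero_beyond_tendsto:
  fixes G :: "real \<Rightarrow> real"
  assumes "\<And>x. x > M \<Longrightarrow> (G has_real_derivative 0) (at x)"
  shows "\<exists>l. (G \<longlongrightarrow> l) at_top"
proof -
  have "\<exists>k. \<forall>x\<in>{M<..}. G x = k"
    by (rule has_field_derivative_zero_constant)
       (use assms in \<open>auto intro: DERIV_subset[where s = UNIV]\<close>)
  then obtain k where "\<forall>x\<in>{M<..}. G x = k" ..
  then have "\<forall>\<^sub>F x in at_top. G x = k"
    by (auto intro: eventually_mono[OF eventually_gt_at_top[of M]])
  then show ?thesis using tendsto_eventually by blast
qed

text \<open>Here c may be negative, in contrast to \<open>Cends_wprim\<close>: where G has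
  derivative zero so has \<open>wprim c G\<close>, hence the latter is constant near each end
  whatever the growth of the weight.\<close>

lemma wprim_Cends_of_constant_ends:
  assumes G: "continuous_on UNIV G"
    and ends: "\<And>x. \<bar>x\<bar> > M \<Longrightarrow> (G has_real_derivative 0) (at x)"
  shows "wprim c G \<in> Cends"
proof -
  have top: "\<exists>l. (wprim c G \<longlongrightarrow> l) at_top"
    if G: "continuous_on UNIV G" and ends: "\<And>x. \<bar>x\<bar> > M \<Longrightarrow> (G has_real_derivative 0) (at x)" for G
  proof (rule DERIV_zero_beyond_tendsto)
    fix x :: real assume "x > \<bar>M\<bar>"
    then show "(wprim c G has_real_derivative 0) (at x)"
      using wprim_DERIV[OF G ends, of x c] by simp
  qed
  have "((\<lambda>x. G (- x)) has_real_derivative 0) (at x)" if "\<bar>x\<bar> > M" for x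
    using that ends[of "- x"] DERIV_mirror[of G 0 x] by simp
  then have "\<exists>l. (wprim c (\<lambda>x. G (- x)) \<longlongrightarrow> l) at_top"
    by (intro top) (auto intro!: continuous_on_compose2[OF G] continuous_intros)
  then show ?thesis
    using wprim_continuous[OF G] top[OF G ends]
    by (simp add: Cends_def wprim_reflect tendsto_at_bot_reflect)
qed

lemma clip_DERIV:
  assumes "\<bar>x\<bar> > M" "M \<ge> 0"
  shows "(clip M G has_real_derivative 0) (at x)"
proof -
  have "((\<lambda>_. clip M G x) has_real_derivative 0) (at x)" by simp
  then show ?thesis
    by (rule has_field_derivative_transform_within_open[where S = "if x > 0 then {M<..} else {..<-M}"])
       (use assms in \<open>auto simp: clip_def max_def min_def\<close>)
qed

lemma clip_approx:
  assumes G: "G \<in> Cends" and e: "e > 0"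
  obtains M where "M > 0" "\<And>x. \<bar>G x - clip M G x\<bar> < e"
proof -
  obtain l m where l: "(G \<longlongrightarrow> l) at_top" and m: "(G \<longlongrightarrow> m) at_bot"
    using G by (auto simp: Cends_def)
  obtain u where u: "\<And>x. x \<ge> u \<Longrightarrow> \<bar>G x - l\<bar> < e / 2"
    using tendstoD[OF l, of "e / 2"] e by (auto simp: eventually_at_top_linorder dist_real_def)
  obtain v where v: "\<And>x. x \<le> v \<Longrightarrow> \<bar>G x - m\<bar> < e / 2"
    using tendstoD[OF m, of "e / 2"] e by (auto simp: eventually_at_bot_linorder dist_real_def)
  define M where "M = \<bar>u\<bar> + \<bar>v\<bar> + 1"
  have M: "M \<ge> u" "- M \<le> v" "M > 0" by (auto simp: M_def)
  have "\<bar>G x - clip M G x\<bar> < e" for x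
  proof -
    consider "x > M" | "x < - M" | "x \<in> {-M..M}" by fastforce
    then show ?thesis
    proof cases
      case 1
      then have "clip M G x = G M" using M by (simp add: clip_def)
      then show ?thesis using u[of x] u[of M] M 1 by linarith
    next
      case 2
      then have "clip M G x = G (- M)" using M by (simp add: clip_def)
      then show ?thesis using v[of x] v[of "- M"] M 2 by linarith
    next
      case 3
      then have "clip M G x = G x" by (simp add: clip_def)
      then show ?thesis using e by simp
    qed
  qed
  then show thesis using that M(3) by blast
qed

section \<open>Primitives of locally integrable functions\<close>

lemma oint_continuous_of_integrable:
  assumes f: "\<And>a b. f integrable_on {a..b}"
  shows "continuous_on UNIV (\<lambda>x. oint 0 x f)"
proof (rule continuous_at_imp_continuous_on, intro ballI)
  fix x :: real
  define a where "a = min 0 x - 1"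
  have "continuous_on {a..x + 1} (\<lambda>y. integral {a..y} f)"
    by (rule indefinite_integral_continuous_1[OF f])
  then have "isCont (\<lambda>y. integral {a..y} f) x"
    by (rule continuous_on_interior) (auto simp: a_def)
  then have "isCont (\<lambda>y. integral {a..y} f - integral {a..0} f) x"
    by (intro continuous_intros)
  moreover have "\<forall>\<^sub>F y in nhds x. integral {a..y} f - integral {a..0} f = oint 0 y f"
    unfolding eventually_nhds
    by (rule exI[of _ "{a<..}"]) (auto simp: a_def oint_eq_diff[OF f, of "min 0 x - 1"])
  ultimately show "isCont (\<lambda>x. oint 0 x f) x"
    using isCont_cong by fastforce
qed

lemma abs_oint_diff_le:
  assumes f: "\<And>a b. f absolutely_integrable_on {a..b}" and "x \<le> y"
  shows "\<bar>oint 0 y f - oint 0 x f\<bar> \<le> oint 0 y (\<lambda>t. \<bar>f t\<bar>) - oint 0 x (\<lambda>t. \<bar>f t\<bar>)"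
proof -
  have "norm (integral {x..y} f) \<le> integral {x..y} (\<lambda>t. \<bar>f t\<bar>)"
    by (rule Henstock_Kurzweil_Integration.integral_norm_bound_integral)
       (use f in \<open>auto simp: absolutely_integrable_on_def\<close>)
  then show ?thesis
    using f assms(2) by (simp add: oint_diff absolutely_integrable_on_def)
qed

lemma absolutely_integrable_mult_continuous:
  fixes f :: "real \<Rightarrow> real"
  assumes "f absolutely_integrable_on {a..b}" "continuous_on UNIV g"
  shows "(\<lambda>x. f x * g x) absolutely_integrable_on {a..b}"
proof -
  have g: "continuous_on {a..b} g" using assms(2) continuous_on_subset by blast
  have "(\<lambda>x. g x * f x) absolutely_integrable_on {a..b}"
  proof (rule absolutely_integrable_bounded_measurable_product_real[OF _ _ _ assms(1)])
    show "g \<in> borel_measurable (lebesgue_on {a..b})"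
      by (rule continuous_imp_measurable_on_sets_lebesgue[OF g]) auto
    show "bounded (g ` {a..b})"
      using compact_continuous_image[OF g] compact_imp_bounded by blast
  qed auto
  then show ?thesis by (simp add: mult.commute)
qed

text \<open>For merely integrable f, the increment of the defect D over a short interval is of the
  order of the interval length times the increment of the integral of the absolute value of f,
  so D has derivative 0 everywhere.\<close>

lemma oint_by_parts:
  assumes f: "\<And>a b. f absolutely_integrable_on {a..b}"
    and g: "\<And>x. (g has_real_derivative g' x) (at x)" and g': "continuous_on UNIV g'"
  shows "oint 0 x (\<lambda>\<xi>. f \<xi> * g \<xi>) = oint 0 x f * g x - oint 0 x (\<lambda>\<xi>. oint 0 \<xi> f * g' \<xi>)"
proof -
  define F where "F x = oint 0 x f" for x
  define A where "A x = oint 0 x (\<lambda>t. \<bar>f t\<bar>)" for x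
  define D where "D x = F x * g x - oint 0 x (\<lambda>\<xi>. F \<xi> * g' \<xi>) - oint 0 x (\<lambda>\<xi>. f \<xi> * g \<xi>)" for x
  have fi: "f integrable_on {a..b}" and fai: "(\<lambda>t. \<bar>f t\<bar>) integrable_on {a..b}" for a b
    using f[of a b] by (auto simp: absolutely_integrable_on_def)
  have gC: "continuous_on UNIV g"
    using g DERIV_isCont continuous_at_imp_continuous_on by blast
  have fgi: "(\<lambda>t. f t * g t) integrable_on {a..b}" for a b
    using absolutely_integrable_mult_continuous[OF f gC] by (simp add: absolutely_integrable_on_def)
  have FC: "continuous_on UNIV F" unfolding F_def by (rule oint_continuous_of_integrable[OF fi])
  have AC: "continuous_on UNIV A" unfolding A_def by (rule oint_continuous_of_integrable[OF fai])
  have FA: "\<bar>F v - F u\<bar> \<le> A v - A u" if "u \<le> v" for u v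
    unfolding F_def A_def by (rule abs_oint_diff_le[OF f that])
  have Fg'C: "continuous_on UNIV (\<lambda>t. F t * g' t)" by (intro continuous_intros FC g')
  \<comment> \<open>D v - D u equals the integral of f(t) (g(v) - g(t)) minus the integral of (F(t)
    - F(u)) g'(t) over [u, v], and each of the two is at most C (v - u) (A v - A u).\<close>
  have inc: "\<bar>D v - D u\<bar> \<le> 2 * C * (v - u) * (A v - A u)"
    if uv: "u \<le> v" and C: "\<And>t. t \<in> {u..v} \<Longrightarrow> \<bar>g' t\<bar> \<le> C" for u v C
  proof -
    have C0: "C \<ge> 0" using C[of u] uv by simp
    have gl: "\<bar>g v - g t\<bar> \<le> C * (v - u)" if t: "t \<in> {u..v}" for t
    proof -
      have "norm (g v - g t) \<le> C * norm (v - t)"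
        by (rule field_differentiable_bound[of "{u..v}" g g'])
           (use C t in \<open>auto intro: has_field_derivative_at_within[OF g]\<close>)
      also have "\<dots> \<le> C * (v - u)" using t C0 by (intro mult_left_mono) auto
      finally show ?thesis by simp
    qed
    have i1: "(\<lambda>t. f t * g v - f t * g t) integrable_on {u..v}"
      by (intro Henstock_Kurzweil_Integration.integrable_diff integrable_on_mult_left fi fgi)
    have i2: "(\<lambda>t. F t * g' t - F u * g' t) integrable_on {u..v}"
      by (intro continuous_integrable_Icc continuous_intros FC g')
    have "norm (integral {u..v} (\<lambda>t. f t * g v - f t * g t)) \<le> integral {u..v} (\<lambda>t. C * (v - u) * \<bar>f t\<bar>)"
    proof (rule Henstock_Kurzweil_Integration.integral_norm_bound_integral[OF i1])
      show "(\<lambda>t. C * (v - u) * \<bar>f t\<bar>) integrable_on {u..v}"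
        by (intro integrable_on_mult_right fai)
      show "norm (f t * g v - f t * g t) \<le> C * (v - u) * \<bar>f t\<bar>" if "t \<in> {u..v}" for t
        using mult_right_mono[OF gl[OF that], of "\<bar>f t\<bar>"]
        by (simp add: mult.commute flip: abs_mult right_diff_distrib)
    qed
    also have "\<dots> = C * (v - u) * (A v - A u)"
      using oint_diff[OF fai uv] by (simp add: A_def)
    finally have 1: "\<bar>integral {u..v} (\<lambda>t. f t * g v - f t * g t)\<bar> \<le> C * (v - u) * (A v - A u)"
      by simp
    have "norm (integral {u..v} (\<lambda>t. F t * g' t - F u * g' t)) \<le> integral {u..v} (\<lambda>t. (A v - A u) * C)"
    proof (rule Henstock_Kurzweil_Integration.integral_norm_bound_integral[OF i2])
      show "norm (F t * g' t - F u * g' t) \<le> (A v - A u) * C" if t: "t \<in> {u..v}" for t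
      proof -
        have "\<bar>F t - F u\<bar> \<le> A v - A u"
          using FA[of u t] FA[of t v] t by simp
        then show ?thesis
          using C[OF t] by (simp add: abs_mult mult_mono flip: left_diff_distrib)
      qed
    qed auto
    then have 2: "\<bar>integral {u..v} (\<lambda>t. F t * g' t - F u * g' t)\<bar> \<le> C * (v - u) * (A v - A u)"
      using uv by (simp add: algebra_simps)
    have "integral {u..v} (\<lambda>t. f t * g v - f t * g t) = (F v - F u) * g v - integral {u..v} (\<lambda>t. f t * g t)"
      using oint_diff[OF fi uv]
      by (subst Henstock_Kurzweil_Integration.integral_diff)
         (auto intro: integrable_on_mult_left fi fgi simp: F_def)
    moreover have "integral {u..v} g' = g v - g u"
      using oint_FTC[OF g] oint_diff[OF continuous_integrable_Icc[OF g'] uv] by simp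
    then have "integral {u..v} (\<lambda>t. F t * g' t - F u * g' t)
        = integral {u..v} (\<lambda>t. F t * g' t) - F u * (g v - g u)"
      by (subst Henstock_Kurzweil_Integration.integral_diff)
         (auto intro!: continuous_integrable_Icc continuous_intros FC g')
    moreover have "D v - D u = F v * g v - F u * g u - integral {u..v} (\<lambda>t. F t * g' t) - integral {u..v} (\<lambda>t. f t * g t)"
      using oint_diff[OF fgi uv] oint_diff[OF continuous_integrable_Icc[OF Fg'C] uv] by (simp add: D_def)
    ultimately have "D v - D u = integral {u..v} (\<lambda>t. f t * g v - f t * g t)
        - integral {u..v} (\<lambda>t. F t * g' t - F u * g' t)"
      by (simp add: algebra_simps)
    then show ?thesis using 1 2 by linarith
  qed
  have "(D has_real_derivative 0) (at x)" for x
  proof -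
    have "continuous_on {x - 1..x + 1} g'"
      using g' by (rule continuous_on_subset) simp
    then have "bounded (g' ` {x - 1..x + 1})"
      by (intro compact_imp_bounded compact_continuous_image) auto
    then obtain C where C: "\<And>t. t \<in> {x - 1..x + 1} \<Longrightarrow> \<bar>g' t\<bar> \<le> C"
      unfolding bounded_real by blast
    have bd: "norm ((D y - D x) / (y - x)) \<le> 2 * C * \<bar>A y - A x\<bar>" if y: "\<bar>y - x\<bar> < 1" "y \<noteq> x" for y
    proof -
      have "\<bar>D y - D x\<bar> \<le> 2 * C * \<bar>y - x\<bar> * \<bar>A y - A x\<bar>"
      proof (cases "y \<ge> x")
        case True
        then show ?thesis using inc[OF True, of C] C y FA[OF True] by simp
      next
        case False
        then have yx: "y \<le> x" by simp
        have "\<bar>D x - D y\<bar> \<le> 2 * C * (x - y) * (A x - A y)"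
          by (rule inc[OF yx]) (use C y yx in auto)
        then show ?thesis using yx FA[OF yx] by (simp add: abs_minus_commute)
      qed
      then show ?thesis using y(2) by (simp add: abs_divide field_simps)
    qed
    have "((\<lambda>y. 2 * C * \<bar>A y - A x\<bar>) \<longlongrightarrow> 2 * C * \<bar>A x - A x\<bar>) (at x)"
      using AC by (intro tendsto_intros) (simp add: continuous_on_def)
    then have "((\<lambda>y. 2 * C * \<bar>A y - A x\<bar>) \<longlongrightarrow> 0) (at x)" by simp
    moreover have "\<forall>\<^sub>F y in at x. norm ((D y - D x) / (y - x)) \<le> 2 * C * \<bar>A y - A x\<bar>"
      unfolding eventually_at dist_real_def using bd zero_less_one by blast
    ultimately have "((\<lambda>y. (D y - D x) / (y - x)) \<longlongrightarrow> 0) (at x)"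
      by (rule Lim_null_comparison[rotated])
    then show ?thesis by (simp add: has_field_derivative_iff)
  qed
  then have "D x = D 0" by (intro DERIV_isconst_all) blast
  then show ?thesis by (simp add: D_def F_def)
qed

text \<open>Integration by parts on an interval containing the support of \<phi>, where the boundary
  terms vanish. It identifies the regular distribution with the derivative of a continuous
  primitive, which \<open>Act\<close> requires.\<close>

lemma regdist_eq_dderiv:
  assumes f: "\<And>a b. f absolutely_integrable_on {a..b}"
  shows "regdist f = dderiv (\<lambda>x. oint 0 x f)"
proof
  fix \<phi>
  show "regdist f \<phi> = dderiv (\<lambda>x. oint 0 x f) \<phi>"
  proof (cases "test_fun \<phi>")
    case True
    obtain M where M: "M > 0" "\<And>x. \<bar>x\<bar> \<ge> M \<Longrightarrow> \<phi> x = 0" "\<And>x. \<bar>x\<bar> \<ge> M \<Longrightarrow> deriv \<phi> x = 0"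
      using test_fun_obtain_support[OF True] by metis
    have sm: "smooth \<phi>" using True by (simp add: test_fun_iff)
    have fi: "f integrable_on {a..b}" for a b
      using f by (simp add: absolutely_integrable_on_def)
    have i1: "(\<lambda>x. f x * \<phi> x) integrable_on {a..b}" for a b
      using absolutely_integrable_mult_continuous[OF f smooth_continuous[OF sm]]
      by (simp add: absolutely_integrable_on_def)
    have i2: "(\<lambda>x. oint 0 x f * deriv \<phi> x) integrable_on {a..b}" for a b
      by (intro continuous_integrable_Icc continuous_intros oint_continuous_of_integrable fi
          smooth_continuous smooth_deriv sm)
    have U1: "integral UNIV (\<lambda>x. f x * \<phi> x) = integral {-M..M} (\<lambda>x. f x * \<phi> x)"
      using M(2) integrable_integral[OF i1] by (intro integral_unique has_integral_UNIV_of_support[of M]) auto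
    have U2: "integral UNIV (\<lambda>x. oint 0 x f * deriv \<phi> x) = integral {-M..M} (\<lambda>x. oint 0 x f * deriv \<phi> x)"
      using M(3) integrable_integral[OF i2] by (intro integral_unique has_integral_UNIV_of_support[of M]) auto
    have parts: "oint 0 x (\<lambda>\<xi>. f \<xi> * \<phi> \<xi>) = oint 0 x f * \<phi> x - oint 0 x (\<lambda>\<xi>. oint 0 \<xi> f * deriv \<phi> \<xi>)" for x
      by (rule oint_by_parts[OF f smooth_DERIV[OF sm] smooth_continuous[OF smooth_deriv[OF sm]]])
    have "integral {-M..M} (\<lambda>x. f x * \<phi> x) = - integral {-M..M} (\<lambda>x. oint 0 x f * deriv \<phi> x)"
      using oint_diff[OF i1, of "-M" M] oint_diff[OF i2, of "-M" M] M(1) M(2)[of M] M(2)[of "-M"]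
      by (simp add: parts)
    then show ?thesis
      using True by (simp add: regdist_def dderiv_def U1 U2)
  qed (simp add: regdist_def dderiv_def)
qed

text \<open>If dF = f dx, the Stieltjes integral against the Gaussian is the ordinary integral of f
  times the Gaussian; this links integrability of f \<open>omega \<tau>\<close> to membership in
  \<open>Act \<tau>\<close>.\<close>

lemma wprim_oint:
  assumes f: "\<And>a b. f absolutely_integrable_on {a..b}"
  shows "wprim c (\<lambda>x. oint 0 x f) x = oint 0 x (\<lambda>\<xi>. f \<xi> * gauss c \<xi>)"
proof -
  have "oint 0 x (\<lambda>\<xi>. f \<xi> * gauss c \<xi>)
      = oint 0 x f * gauss c x - oint 0 x (\<lambda>\<xi>. oint 0 \<xi> f * (- (2 * c * \<xi> * gauss c \<xi>)))"
    by (rule oint_by_parts[OF f gauss_DERIV]) (intro continuous_intros)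
  moreover have "oint 0 x (\<lambda>\<xi>. oint 0 \<xi> f * (- (2 * c * \<xi> * gauss c \<xi>)))
      = (- 2 * c) * oint 0 x (\<lambda>\<xi>. oint 0 \<xi> f * \<xi> * gauss c \<xi>)"
    unfolding oint_cmult[symmetric] by (simp add: mult_ac)
  ultimately show ?thesis by (simp add: wprim_def)
qed

lemma oint_Cends:
  assumes h: "h absolutely_integrable_on UNIV"
  shows "(\<lambda>x. oint 0 x h) \<in> Cends"
proof -
  have habs: "h absolutely_integrable_on {a..b}" for a b
    using absolutely_integrable_on_subinterval[OF h] by auto
  have hi: "h integrable_on {a..b}" and ai: "(\<lambda>x. \<bar>h x\<bar>) integrable_on {a..b}" for a b
    using habs[of a b] by (auto simp: absolutely_integrable_on_def)
  have ari: "(\<lambda>x. \<bar>h (- x)\<bar>) integrable_on {a..b}" for a b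
    using Henstock_Kurzweil_Integration.integrable_reflect_real[of "\<lambda>x. \<bar>h x\<bar>" "-a" "-b"] ai[of "-b" "-a"]
    by simp
  have Ui: "(\<lambda>x. \<bar>h x\<bar>) integrable_on UNIV"
    using h by (simp add: absolutely_integrable_on_def)
  \<comment> \<open>Adding the reflection gives a single majorant in |x| for both half-lines, as
    \<open>oint_dominated\<close> expects.\<close>
  define k where "k x = \<bar>h x\<bar> + \<bar>h (- x)\<bar>" for x
  have ki: "k integrable_on {a..b}" for a b
    unfolding k_def by (intro Henstock_Kurzweil_Integration.integrable_add ai ari)
  have hk: "\<bar>h x\<bar> \<le> k \<bar>x\<bar>" for x
    by (cases "x \<ge> 0") (auto simp: k_def)
  have kB: "oint 0 x k \<le> 2 * integral UNIV (\<lambda>x. \<bar>h x\<bar>)" if x: "x \<ge> 0" for x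
  proof -
    have "oint 0 x k = integral {0..x} (\<lambda>x. \<bar>h x\<bar>) + integral {0..x} (\<lambda>x. \<bar>h (- x)\<bar>)"
      using x unfolding oint_def k_def
      by (simp add: Henstock_Kurzweil_Integration.integral_add ai ari)
    also have "integral {0..x} (\<lambda>x. \<bar>h (- x)\<bar>) = integral {-x..0} (\<lambda>x. \<bar>h x\<bar>)"
      using Henstock_Kurzweil_Integration.integral_reflect_real[of 0 "-x" "\<lambda>x. \<bar>h x\<bar>"] by simp
    also have "integral {0..x} (\<lambda>x. \<bar>h x\<bar>) \<le> integral UNIV (\<lambda>x. \<bar>h x\<bar>)"
      by (rule integral_subset_le[OF _ ai Ui]) auto
    also have "integral {-x..0} (\<lambda>x. \<bar>h x\<bar>) \<le> integral UNIV (\<lambda>x. \<bar>h x\<bar>)"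
      by (rule integral_subset_le[OF _ ai Ui]) auto
    finally show ?thesis by simp
  qed
  show ?thesis
    using oint_dominated[OF hi ki hk kB] oint_continuous_of_integrable[OF hi]
    by (auto simp: Cends_def)
qed

section \<open>Uniform approximation by continuously differentiable functions\<close>

text \<open>Clamping the argument to [-M, M] does not increase distances, so the uniform continuity
  of G on this compact interval extends to the whole line.\<close>

lemma clip_uniform:
  assumes G: "continuous_on UNIV G" and e: "e > 0" and M: "M \<ge> 0"
  obtains d where "d > 0" "\<And>x y. \<bar>x - y\<bar> < d \<Longrightarrow> \<bar>clip M G x - clip M G y\<bar> < e"
proof -
  have "uniformly_continuous_on {-M..M} G"
    by (rule compact_uniformly_continuous) (use G continuous_on_subset in auto)
  then obtain d where d: "d > 0"
    "\<And>x y. x \<in> {-M..M} \<Longrightarrow> y \<in> {-M..M} \<Longrightarrow> dist y x < d \<Longrightarrow> dist (G y) (G x) < e"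
    unfolding uniformly_continuous_on_def using e by metis
  have "\<bar>clip M G x - clip M G y\<bar> < e" if "\<bar>x - y\<bar> < d" for x y
  proof -
    have "dist (max (- M) (min M x)) (max (- M) (min M y)) < d"
      using that by (auto simp: dist_real_def max_def min_def)
    then show ?thesis
      using d(2)[of "max (- M) (min M y)" "max (- M) (min M x)"] M
      by (simp add: clip_def dist_real_def)
  qed
  then show thesis using that d(1) by blast
qed

text \<open>K averages the clipped function over [x, x + h]. Averaging gains one derivative, uniform
  continuity bounds the error, and the derivative vanishes once x and x + h lie in the same constant
  part.\<close>

lemma Cends_smooth_approx:
  assumes G: "G \<in> Cends" and e: "e > 0"
  obtains K \<gamma> L where "\<And>x. \<bar>G x - K x\<bar> < e" "\<And>x. (K has_real_derivative \<gamma> x) (at x)"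
    "continuous_on UNIV \<gamma>" "\<And>x. \<bar>x\<bar> \<ge> L \<Longrightarrow> \<gamma> x = 0"
proof -
  obtain M where M: "M > 0" "\<And>x. \<bar>G x - clip M G x\<bar> < e / 2"
    using clip_approx[OF G, of "e / 2"] e by auto
  define C where "C = clip M G"
  have CC: "continuous_on UNIV C"
    unfolding C_def by (rule continuous_clip[OF Cends_continuous[OF G]])
  obtain d where d: "d > 0" "\<And>x y. \<bar>x - y\<bar> < d \<Longrightarrow> \<bar>C x - C y\<bar> < e / 2"
    using clip_uniform[OF Cends_continuous[OF G], of "e / 2" M] e M(1) unfolding C_def by auto
  define P where "P x = oint 0 x C" for x
  have P': "(P has_real_derivative C x) (at x)" for x
    unfolding P_def by (rule oint_DERIV[OF CC])
  define h where "h = d / 2"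
  have h: "h > 0" "h < d" using d(1) by (auto simp: h_def)
  show thesis
  proof (rule that[of "\<lambda>x. (P (x + h) - P x) / h" "\<lambda>x. (C (x + h) - C x) / h" "M + h + 1"])
    fix x
    obtain z where z: "x < z" "z < x + h" "P (x + h) - P x = (x + h - x) * C z"
      using MVT2[of x "x + h" P C] P' h by auto
    then have "(P (x + h) - P x) / h = C z" using h by simp
    moreover have "\<bar>C x - C z\<bar> < e / 2" using d(2)[of x z] z h by simp
    moreover have "\<bar>G x - C x\<bar> < e / 2" using M(2) by (simp add: C_def)
    ultimately show "\<bar>G x - (P (x + h) - P x) / h\<bar> < e" by linarith
  next
    fix x
    have "((\<lambda>x. P (x + h)) has_real_derivative C (x + h)) (at x)"
      using P'[of "x + h"] by (simp add: DERIV_shift)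
    then show "((\<lambda>x. (P (x + h) - P x) / h) has_real_derivative (C (x + h) - C x) / h) (at x)"
      using P' by (auto intro!: derivative_eq_intros DERIV_cdivide)
  next
    show "continuous_on UNIV (\<lambda>x. (C (x + h) - C x) / h)"
      using h by (intro continuous_intros continuous_on_compose2[OF CC] CC) auto
  next
    fix x :: real assume x: "\<bar>x\<bar> \<ge> M + h + 1"
    then have "C (x + h) = C x"
      using M(1) h x by (auto simp: C_def clip_def max_def min_def)
    then show "(C (x + h) - C x) / h = 0" by simp
  qed
qed

section \<open>Completeness and isometries\<close>

text \<open>Let y tend to minus infinity in |G x - G y|. On \<open>Bc\<close> the oscillation thus
  dominates the supremum norm, so Cauchy sequences converge uniformly.\<close>

lemma Bc_abs_le:
  assumes G: "G \<in> Bc"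
  shows "\<bar>G x\<bar> \<le> bnorm G"
proof -
  have "((\<lambda>y. \<bar>G x - G y\<bar>) \<longlongrightarrow> \<bar>G x - 0\<bar>) at_bot"
    using G by (intro tendsto_intros) (simp add: Bc_iff)
  then have "\<bar>G x - 0\<bar> \<le> bnorm G"
    using G bnorm_ge by (intro tendsto_upperbound) (auto simp: Bc_iff)
  then show ?thesis by simp
qed

lemma bnorm_cmult_le: "G \<in> Cends \<Longrightarrow> bnorm (\<lambda>x. c * G x) \<le> \<bar>c\<bar> * bnorm G"
  by (rule bnorm_le) (simp add: bnorm_ge mult_left_mono abs_mult flip: right_diff_distrib)

lemma bnorm_cmult:
  assumes G: "G \<in> Cends"
  shows "bnorm (\<lambda>x. c * G x) = \<bar>c\<bar> * bnorm G"
proof (cases "c = 0")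
  case True
  then show ?thesis
    using bnorm_cmult_le[OF G, of 0] bnorm_nonneg[OF Cends_const[of 0]] by simp
next
  case False
  have "bnorm G \<le> \<bar>1 / c\<bar> * bnorm (\<lambda>x. c * G x)"
    using bnorm_cmult_le[OF Cends_cmult[OF G], of "1 / c" c] False by simp
  then show ?thesis
    using bnorm_cmult_le[OF G, of c] False by (simp add: field_simps)
qed

lemma bnorm_triangle:
  assumes "F \<in> Cends" "G \<in> Cends"
  shows "bnorm (\<lambda>x. F x + G x) \<le> bnorm F + bnorm G"
proof (rule bnorm_le)
  show "\<bar>F x + G x - (F y + G y)\<bar> \<le> bnorm F + bnorm G" for x y
    using bnorm_ge[OF assms(1), of x y] bnorm_ge[OF assms(2), of x y] by linarith
qed

lemma Bc_add: "F \<in> Bc \<Longrightarrow> G \<in> Bc \<Longrightarrow> (\<lambda>x. F x + G x) \<in> Bc"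
  using tendsto_add[of F 0 at_bot G 0] by (simp add: Bc_iff Cends_add)

lemma Bc_cmult: "G \<in> Bc \<Longrightarrow> (\<lambda>x. c * G x) \<in> Bc"
  using tendsto_mult_left[of G 0 at_bot c] by (simp add: Bc_iff Cends_cmult)

lemma Bc_diff: "F \<in> Bc \<Longrightarrow> G \<in> Bc \<Longrightarrow> (\<lambda>x. F x - G x) \<in> Bc"
  using tendsto_diff[of F 0 at_bot G 0] by (simp add: Bc_iff Cends_diff)

text \<open>The uniform limit inherits continuity and the limit at minus infinity. For plus
  infinity, the limits t n form a Cauchy sequence because differences of limits obey the same bound
  as differences of values, and interchanging limits gives the limit of L.\<close>

lemma Bc_complete:
  assumes X: "\<And>n. X n \<in> Bc"
    and Cau: "\<forall>e>0. \<exists>M. \<forall>m\<ge>M. \<forall>n\<ge>M. bnorm (\<lambda>x. X m x - X n x) < e"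
  shows "\<exists>L\<in>Bc. (\<lambda>n. bnorm (\<lambda>x. X n x - L x)) \<longlonglongrightarrow> 0"
proof -
  have close: "\<bar>X m x - X n x\<bar> \<le> bnorm (\<lambda>x. X m x - X n x)" for m n x
    by (rule Bc_abs_le[OF Bc_diff[OF X X]])
  have "uniformly_Cauchy_on UNIV X"
    unfolding uniformly_Cauchy_on_def dist_real_def using Cau close by (meson order_le_less_trans)
  then obtain L where L: "uniform_limit UNIV X L sequentially"
    using Cauchy_uniformly_convergent uniformly_convergent_on_def by blast
  have near: "\<exists>M. \<forall>n\<ge>M. \<forall>x. \<bar>X n x - L x\<bar> < e" if "e > 0" for e
    using L that unfolding uniform_limit_iff eventually_sequentially dist_real_def by blast
  have LC: "continuous_on UNIV L"
    by (rule uniform_limit_theorem[OF _ L]) (use X in \<open>auto simp: Bc_iff Cends_continuous\<close>)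
  have "\<forall>n. \<exists>l. (X n \<longlongrightarrow> l) at_top"
    using X by (simp add: Bc_iff Cends_def)
  then obtain t where t: "\<And>n. (X n \<longlongrightarrow> t n) at_top" by metis
  have tt: "\<bar>t m - t n\<bar> \<le> bnorm (\<lambda>x. X m x - X n x)" for m n
  proof -
    have "((\<lambda>x. \<bar>X m x - X n x\<bar>) \<longlongrightarrow> \<bar>t m - t n\<bar>) at_top"
      by (intro tendsto_intros t)
    then show ?thesis using close by (intro tendsto_upperbound) auto
  qed
  have "Cauchy t"
    unfolding Cauchy_def dist_real_def using Cau tt by (meson order_le_less_trans)
  then obtain l where l: "t \<longlonglongrightarrow> l"
    using Cauchy_convergent convergent_def by blast
  have "(L \<longlongrightarrow> l) at_top"
  proof (rule tendstoI)
    fix e :: real assume "e > 0"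
    then obtain M where M: "\<And>n x. n \<ge> M \<Longrightarrow> \<bar>X n x - L x\<bar> < e / 3"
      using near[of "e / 3"] by auto
    obtain M' where M': "\<And>n. n \<ge> M' \<Longrightarrow> \<bar>t n - l\<bar> < e / 3"
      using l \<open>e > 0\<close> unfolding lim_sequentially dist_real_def by (meson divide_pos_pos zero_less_numeral)
    define n where "n = max M M'"
    have "\<forall>\<^sub>F x in at_top. \<bar>X n x - t n\<bar> < e / 3"
      using tendstoD[OF t[of n], of "e / 3"] \<open>e > 0\<close> by (simp add: dist_real_def)
    then show "\<forall>\<^sub>F x in at_top. dist (L x) l < e"
    proof (rule eventually_mono)
      show "dist (L x) l < e" if "\<bar>X n x - t n\<bar> < e / 3" for x
      proof -
        have "\<bar>X n x - L x\<bar> < e / 3" "\<bar>t n - l\<bar> < e / 3"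
          using M[of n x] M'[of n] by (simp_all add: n_def)
        then show ?thesis using that unfolding dist_real_def by linarith
      qed
    qed
  qed
  moreover have "(L \<longlongrightarrow> 0) at_bot"
  proof (rule tendstoI)
    fix e :: real assume "e > 0"
    then obtain n where n: "\<And>x. \<bar>X n x - L x\<bar> < e / 2"
      using near[of "e / 2"] by auto
    have "(X n \<longlongrightarrow> 0) at_bot" using X by (simp add: Bc_iff)
    then have "\<forall>\<^sub>F x in at_bot. \<bar>X n x\<bar> < e / 2"
      using tendstoD[of "X n" 0 at_bot "e / 2"] \<open>e > 0\<close> by (simp add: dist_real_def)
    then show "\<forall>\<^sub>F x in at_bot. dist (L x) 0 < e"
    proof (rule eventually_mono)
      show "dist (L x) 0 < e" if "\<bar>X n x\<bar> < e / 2" for x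
        using that n[of x] unfolding dist_real_def by linarith
    qed
  qed
  ultimately have LB: "L \<in> Bc"
    using LC by (auto simp: Bc_def)
  have "(\<lambda>n. bnorm (\<lambda>x. X n x - L x)) \<longlonglongrightarrow> 0"
  proof (rule LIMSEQ_I)
    fix e :: real assume "e > 0"
    then obtain M where M: "\<And>n x. n \<ge> M \<Longrightarrow> \<bar>X n x - L x\<bar> < e / 3"
      using near[of "e / 3"] by auto
    have "norm (bnorm (\<lambda>x. X n x - L x) - 0) < e" if "n \<ge> M" for n
    proof -
      have "\<bar>X n x - L x - (X n y - L y)\<bar> \<le> 2 * (e / 3)" for x y
        using M[OF that, of x] M[OF that, of y] by linarith
      then have "bnorm (\<lambda>x. X n x - L x) \<le> 2 * (e / 3)"
        by (rule bnorm_le)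
      moreover have "bnorm (\<lambda>x. X n x - L x) \<ge> 0"
        using Bc_diff[OF X LB] by (simp add: Bc_iff bnorm_nonneg)
      ultimately show ?thesis using \<open>e > 0\<close> by simp
    qed
    then show "\<exists>M. \<forall>n\<ge>M. norm (bnorm (\<lambda>x. X n x - L x) - 0) < e" by blast
  qed
  then show ?thesis using LB by blast
qed

lemma banach_Bc: "banach_fun_on Bc bnorm"
  unfolding banach_fun_on_def
proof (intro conjI ballI allI impI)
  show "lin_subspace_fun Bc"
    unfolding lin_subspace_fun_def by (auto simp: Bc_add Bc_cmult) (simp add: Bc_iff Cends_const)
  fix G assume G: "G \<in> Bc"
  then show "bnorm G \<ge> 0" by (simp add: Bc_iff bnorm_nonneg)
  show "bnorm G = 0 \<longleftrightarrow> G = (\<lambda>_. 0)"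
  proof
    assume "bnorm G = 0"
    then show "G = (\<lambda>_. 0)" using Bc_abs_le[OF G] by auto
  next
    assume "G = (\<lambda>_. 0)"
    then show "bnorm G = 0" using bnorm_cmult[OF Cends_const[of 0], of 0] by simp
  qed
  show "bnorm (\<lambda>x. c * G x) = \<bar>c\<bar> * bnorm G" for c
    using G by (simp add: Bc_iff bnorm_cmult)
  show "bnorm (\<lambda>x. G x + H x) \<le> bnorm G + bnorm H" if "H \<in> Bc" for H
    using G that by (simp add: Bc_iff bnorm_triangle)
next
  fix X :: "nat \<Rightarrow> real \<Rightarrow> real"
  assume "\<forall>n. X n \<in> Bc" "\<forall>e>0. \<exists>M. \<forall>m\<ge>M. \<forall>n\<ge>M. bnorm (\<lambda>x. X m x - X n x) < e"
  then show "\<exists>L\<in>Bc. (\<lambda>n. bnorm (\<lambda>x. X n x - L x)) \<longlonglongrightarrow> 0"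
    by (intro Bc_complete) auto
qed

section \<open>Transfer of completeness along isometries\<close>

text \<open>The subspace property is a separate assumption because the equations for h in
  \<open>isometric_iso_fun\<close> do not force sums and multiples of members of S to lie in
  S.\<close>

lemma banach_fun_on_transfer:
  assumes iso: "isometric_iso_fun S N T M" and T: "banach_fun_on T M" and S: "lin_subspace_fun S"
  shows "banach_fun_on S N"
proof -
  obtain h where "bij_betw h S T \<and>
     (\<forall>f\<in>S. \<forall>g\<in>S. h (\<lambda>x. f x + g x) = (\<lambda>x. h f x + h g x)) \<and>
     (\<forall>c. \<forall>f\<in>S. h (\<lambda>x. c * f x) = (\<lambda>x. c * h f x)) \<and>
     (\<forall>f\<in>S. M (h f) = N f)"
    using iso unfolding isometric_iso_fun_def ..
  then have h: "bij_betw h S T"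
    and add: "f \<in> S \<Longrightarrow> g \<in> S \<Longrightarrow> h (\<lambda>x. f x + g x) = (\<lambda>x. h f x + h g x)"
    and mult: "f \<in> S \<Longrightarrow> h (\<lambda>x. c * f x) = (\<lambda>x. c * h f x)"
    and nrm: "f \<in> S \<Longrightarrow> M (h f) = N f" for c f g
    by simp_all
  have S0: "(\<lambda>_. 0) \<in> S" and Sadd: "f \<in> S \<Longrightarrow> g \<in> S \<Longrightarrow> (\<lambda>x. f x + g x) \<in> S"
    and Smult: "f \<in> S \<Longrightarrow> (\<lambda>x. c * f x) \<in> S" for c f g
    using S unfolding lin_subspace_fun_def by simp_all
  have hT: "h f \<in> T" if "f \<in> S" for f using h that by (auto simp: bij_betw_def)
  have h0: "h (\<lambda>_. 0) = (\<lambda>_. 0)" using mult[OF S0, of 0] by simp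
  have Sdiff: "(\<lambda>x. f x - g x) \<in> S" and hdiff: "h (\<lambda>x. f x - g x) = (\<lambda>x. h f x - h g x)"
    if "f \<in> S" "g \<in> S" for f g
    using Sadd[OF that(1) Smult[OF that(2), of "-1"]] add[OF that(1) Smult[OF that(2), of "-1"]]
      mult[OF that(2), of "-1"] by simp_all
  have Tn: "f \<in> T \<Longrightarrow> M f \<ge> 0" "f \<in> T \<Longrightarrow> M f = 0 \<longleftrightarrow> f = (\<lambda>_. 0)"
    "f \<in> T \<Longrightarrow> M (\<lambda>x. c * f x) = \<bar>c\<bar> * M f"
    "f \<in> T \<Longrightarrow> g \<in> T \<Longrightarrow> M (\<lambda>x. f x + g x) \<le> M f + M g" for c f g
    using T unfolding banach_fun_on_def by simp_all
  have Tc: "\<exists>L\<in>T. (\<lambda>n. M (\<lambda>x. X n x - L x)) \<longlonglongrightarrow> 0"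
    if "\<forall>n. X n \<in> T" "\<forall>e>0. \<exists>K. \<forall>m\<ge>K. \<forall>n\<ge>K. M (\<lambda>x. X m x - X n x) < e" for X
    using T that unfolding banach_fun_on_def by simp
  show ?thesis
    unfolding banach_fun_on_def
  proof (intro conjI ballI allI impI S)
    fix f assume f: "f \<in> S"
    show "N f \<ge> 0" using Tn(1)[OF hT[OF f]] nrm[OF f] by simp
    show "N f = 0 \<longleftrightarrow> f = (\<lambda>_. 0)"
    proof
      assume "N f = 0"
      then have "h f = h (\<lambda>_. 0)" using Tn(2)[OF hT[OF f]] nrm[OF f] h0 by simp
      then show "f = (\<lambda>_. 0)" using h f S0 by (auto simp: bij_betw_def inj_on_def)
    next
      assume "f = (\<lambda>_. 0)"
      then show "N f = 0" using Tn(2)[OF hT[OF f]] nrm[OF f] h0 by simp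
    qed
    show "N (\<lambda>x. c * f x) = \<bar>c\<bar> * N f" for c
      using Tn(3)[OF hT[OF f], of c] nrm[OF f] nrm[OF Smult[OF f, of c]] mult[OF f, of c] by simp
    show "N (\<lambda>x. f x + g x) \<le> N f + N g" if g: "g \<in> S" for g
      using Tn(4)[OF hT[OF f] hT[OF g]] nrm[OF f] nrm[OF g] nrm[OF Sadd[OF f g]] add[OF f g] by simp
  next
    fix X :: "nat \<Rightarrow> 'a \<Rightarrow> real"
    assume X: "\<forall>n. X n \<in> S"
      and C: "\<forall>e>0. \<exists>M. \<forall>m\<ge>M. \<forall>n\<ge>M. N (\<lambda>x. X m x - X n x) < e"
    have eq: "M (\<lambda>x. h f x - h g x) = N (\<lambda>x. f x - g x)" if "f \<in> S" "g \<in> S" for f g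
      using nrm[OF Sdiff[OF that]] hdiff[OF that] by simp
    have "\<exists>L\<in>T. (\<lambda>n. M (\<lambda>x. h (X n) x - L x)) \<longlonglongrightarrow> 0"
      by (rule Tc) (use X C hT in \<open>simp_all add: eq\<close>)
    then obtain L where L: "L \<in> T" "(\<lambda>n. M (\<lambda>x. h (X n) x - L x)) \<longlonglongrightarrow> 0" ..
    obtain K where K: "K \<in> S" "L = h K"
      using L(1) h unfolding bij_betw_def by blast
    then show "\<exists>L\<in>S. (\<lambda>n. N (\<lambda>x. X n x - L x)) \<longlonglongrightarrow> 0"
      using L(2) X by (intro bexI[of _ K]) (simp_all add: eq)
  qed
qed

text \<open>Choosing the normalising constant by \<open>Lim\<close> gives the isometry onto
  \<open>Bc\<close> as one explicit map instead of a constant obtained anew for each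
  function.\<close>

definition vanish_at_bot :: "(real \<Rightarrow> real) \<Rightarrow> real \<Rightarrow> real" where
  "vanish_at_bot G x = G x - Lim at_bot G"

lemma vanish_at_bot_Bc:
  assumes "G \<in> Cends"
  shows "vanish_at_bot G \<in> Bc"
proof -
  obtain m where m: "(G \<longlongrightarrow> m) at_bot" using assms by (auto simp: Cends_def)
  have "Lim at_bot G = m"
    by (rule tendsto_Lim[OF trivial_limit_at_bot_linorder m])
  then have "vanish_at_bot G = (\<lambda>x. G x - m)"
    by (simp add: vanish_at_bot_def fun_eq_iff)
  moreover have "((\<lambda>x. G x - m) \<longlongrightarrow> m - m) at_bot"
    by (intro tendsto_diff m tendsto_const)
  ultimately show ?thesis using Cends_diff[OF assms Cends_const] by (simp add: Bc_iff)
qed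

lemma vanish_at_bot_unique:
  assumes "G \<in> Cends" "H \<in> Bc" "\<And>x. G x - G 0 = H x - H 0"
  shows "vanish_at_bot G = H"
  by (rule Bc_unique[OF vanish_at_bot_Bc[OF assms(1)] assms(2)]) (simp add: vanish_at_bot_def assms(3))

lemma bnorm_vanish_at_bot: "bnorm (vanish_at_bot G) = bnorm G"
  by (simp add: vanish_at_bot_def[abs_def])

lemma Bct_lin_subspace: "lin_subspace_fun (Bct \<tau>)"
  unfolding lin_subspace_fun_def
  by (auto simp: Bct_iff wprim_add wprim_cmult Cends_add Cends_cmult Cends_const
      intro!: continuous_on_add continuous_on_mult_left)

text \<open>The two spaces are normalised at different places. The isometry renormalises at minus
  infinity after applying \<open>wprim\<close>, and its inverse renormalises at 0 before applying
  \<open>wprim (- c)\<close>.\<close>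

lemma Bct_iso: "isometric_iso_fun (Bct \<tau>) (norm_Bct \<tau>) Bc bnorm"
proof -
  define c where "c = 1 / (4 * \<tau>)"
  let ?h = "\<lambda>F. vanish_at_bot (wprim c F)"
  have F: "continuous_on UNIV F" "F 0 = 0" "wprim c F \<in> Cends" if "F \<in> Bct \<tau>" for F
    using that by (auto simp: Bct_iff c_def)
  have inv_wprim: "wprim c (wprim (- c) (\<lambda>x. G x - G 0)) = (\<lambda>x. G x - G 0)" if "G \<in> Bc" for G
    using that by (intro wprim_inverse continuous_intros) (auto simp: Bc_iff Cends_continuous)
  show ?thesis
    unfolding isometric_iso_fun_def
  proof (intro exI[of _ ?h] conjI ballI allI)
    show "bij_betw ?h (Bct \<tau>) Bc"
    proof (rule bij_betwI[where g = "\<lambda>G. wprim (- c) (\<lambda>x. G x - G 0)"])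
      show "?h \<in> Bct \<tau> \<rightarrow> Bc" using F vanish_at_bot_Bc by blast
      show "(\<lambda>G. wprim (- c) (\<lambda>x. G x - G 0)) \<in> Bc \<rightarrow> Bct \<tau>"
      proof
        fix G assume G: "G \<in> Bc"
        then show "wprim (- c) (\<lambda>x. G x - G 0) \<in> Bct \<tau>"
          using inv_wprim[OF G] wprim_continuous[of "\<lambda>x. G x - G 0" "- c"]
          by (auto simp: Bct_iff Bc_iff Cends_diff Cends_const Cends_continuous simp flip: c_def)
      qed
      show "wprim (- c) (\<lambda>x. ?h F x - ?h F 0) = F" if "F \<in> Bct \<tau>" for F
        using F[OF that] by (simp add: vanish_at_bot_def wprim_inverse)
      show "?h (wprim (- c) (\<lambda>x. G x - G 0)) = G" if "G \<in> Bc" for G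
        unfolding inv_wprim[OF that]
        by (rule vanish_at_bot_unique) (use that in \<open>auto simp: Bc_iff Cends_diff Cends_const\<close>)
    qed
    fix f assume f: "f \<in> Bct \<tau>"
    show "?h (\<lambda>x. f x + g x) = (\<lambda>x. ?h f x + ?h g x)" if g: "g \<in> Bct \<tau>" for g
      using F[OF f] F[OF g]
      by (intro vanish_at_bot_unique)
         (auto simp: wprim_add Cends_add Bc_add vanish_at_bot_Bc, simp add: vanish_at_bot_def)
    show "?h (\<lambda>x. k * f x) = (\<lambda>x. k * ?h f x)" for k
      using F[OF f]
      by (intro vanish_at_bot_unique)
         (auto simp: wprim_cmult Cends_cmult Bc_cmult vanish_at_bot_Bc, simp add: vanish_at_bot_def algebra_simps)
    show "bnorm (?h f) = norm_Bct \<tau> f"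
      using norm_Bct_eq[OF f] by (simp add: bnorm_vanish_at_bot c_def)
  qed
qed

lemma AcI: "G \<in> Cends \<Longrightarrow> dderiv G \<in> Ac"
  by (auto simp: Ac_iff)

lemma Ac_lin_subspace: "lin_subspace_fun Ac"
proof -
  have "(\<lambda>_. 0) \<in> Ac"
    using AcI[OF Cends_const[of 0]] by (simp add: dderiv_const)
  moreover have "(\<lambda>\<phi>. f \<phi> + g \<phi>) \<in> Ac" if fg: "f \<in> Ac" "g \<in> Ac" for f g
  proof -
    obtain F G where FG: "F \<in> Cends" "G \<in> Cends" "f = dderiv F" "g = dderiv G"
      using fg by (auto simp: Ac_iff)
    then show ?thesis
      using AcI[OF Cends_add[OF FG(1,2)]] by (simp add: dderiv_add Cends_continuous)
  qed
  moreover have "(\<lambda>\<phi>. k * f \<phi>) \<in> Ac" if f: "f \<in> Ac" for f k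
  proof -
    obtain F where F: "F \<in> Cends" "f = dderiv F"
      using f by (auto simp: Ac_iff)
    then show ?thesis
      using AcI[OF Cends_cmult[OF F(1), of k]] by (simp add: dderiv_cmult)
  qed
  ultimately show ?thesis unfolding lin_subspace_fun_def by blast
qed

lemma Ac_iso: "isometric_iso_fun Ac alex Bc bnorm"
  unfolding isometric_iso_fun_def
proof (intro exI[of _ prim] conjI ballI allI)
  have AcD: "\<exists>G\<in>Bc. f = dderiv G" if "f \<in> Ac" for f using that by (auto simp: Ac_def)
  show "bij_betw prim Ac Bc"
    by (rule bij_betwI[where g = dderiv]) (auto simp: Ac_def prim_dderiv)
  fix f assume "f \<in> Ac"
  then obtain F where F: "F \<in> Bc" "f = dderiv F" using AcD by blast
  show "prim (\<lambda>\<phi>. f \<phi> + g \<phi>) = (\<lambda>x. prim f x + prim g x)" if g: "g \<in> Ac" for g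
  proof -
    obtain G where G: "G \<in> Bc" "g = dderiv G" using AcD g by blast
    have "(\<lambda>\<phi>. f \<phi> + g \<phi>) = dderiv (\<lambda>x. F x + G x)"
      using F G by (simp add: dderiv_add Bc_iff Cends_continuous)
    then show ?thesis using F G by (simp add: prim_dderiv Bc_add)
  qed
  show "prim (\<lambda>\<phi>. k * f \<phi>) = (\<lambda>x. k * prim f x)" for k
    using F by (simp add: prim_dderiv Bc_cmult flip: dderiv_cmult)
  show "bnorm (prim f) = alex f" by (simp add: alex_def)
qed

text \<open>Multiplication by the weight 1 is the identity on functionals that vanish off the test
  functions, as every \<open>dderiv F\<close> does.\<close>

lemma gmul_inverse_dderiv: "gmul (- c) (gmul c (dderiv F)) = dderiv F" "gmul c (gmul (- c) (dderiv F)) = dderiv F"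
proof -
  have "gmul 0 (dderiv F) = dderiv F"
    by (auto simp: gmul_def dderiv_def fun_eq_iff)
  then show "gmul (- c) (gmul c (dderiv F)) = dderiv F" "gmul c (gmul (- c) (dderiv F)) = dderiv F"
    by (simp_all add: gmul_gmul)
qed

lemma Act_gmul_Ac:
  assumes "f \<in> Act \<tau>"
  shows "gmul (1 / (4 * \<tau>)) f \<in> Ac" "norm_Act \<tau> f = alex (gmul (1 / (4 * \<tau>)) f)"
  using assms by (auto simp: Act_iff Ac_iff gmul_dderiv norm_Act_dderiv alex_dderiv)

lemma gmul_Ac_Act:
  assumes "g \<in> Ac"
  shows "gmul (- (1 / (4 * \<tau>))) g \<in> Act \<tau>"
proof -
  obtain G where G: "G \<in> Cends" "g = dderiv G" using assms by (auto simp: Ac_iff)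
  then show ?thesis
    by (auto simp: Act_iff gmul_dderiv Cends_continuous wprim_continuous wprim_inverse
        intro!: exI[of _ "wprim (- (1 / (4 * \<tau>))) G"])
qed

lemma Act_iso: "isometric_iso_fun (Act \<tau>) (norm_Act \<tau>) Ac alex"
proof -
  define c where "c = 1 / (4 * \<tau>)"
  show ?thesis
    unfolding isometric_iso_fun_def
  proof (intro exI[of _ "gmul c"] conjI ballI allI)
    show "bij_betw (gmul c) (Act \<tau>) Ac"
    proof (rule bij_betwI[where g = "gmul (- c)"])
      show "gmul c \<in> Act \<tau> \<rightarrow> Ac" "gmul (- c) \<in> Ac \<rightarrow> Act \<tau>"
        using Act_gmul_Ac gmul_Ac_Act by (auto simp: c_def)
    qed (auto simp: Act_iff Ac_iff gmul_inverse_dderiv)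
    show "gmul c (\<lambda>x. f x + g x) = (\<lambda>x. gmul c f x + gmul c g x)" for f g
      by (auto simp: gmul_def)
    show "gmul c (\<lambda>x. k * f x) = (\<lambda>x. k * gmul c f x)" for f k
      by (auto simp: gmul_def)
    show "alex (gmul c f) = norm_Act \<tau> f" if "f \<in> Act \<tau>" for f
      using Act_gmul_Ac[OF that] by (simp add: c_def)
  qed
qed

lemma Act_lin_subspace: "lin_subspace_fun (Act \<tau>)"
proof -
  have "(\<lambda>_. 0) \<in> Act \<tau>"
    using Cends_const[of 0] dderiv_const[of 0]
    by (auto simp: Act_iff intro!: exI[of _ "\<lambda>x. 0"])
  moreover have "(\<lambda>\<phi>. f \<phi> + g \<phi>) \<in> Act \<tau>" if fg: "f \<in> Act \<tau>" "g \<in> Act \<tau>" for f g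
  proof -
    obtain F where F: "continuous_on UNIV F" "wprim (1 / (4 * \<tau>)) F \<in> Cends" "f = dderiv F"
      using fg(1) by (auto simp: Act_iff)
    obtain G where G: "continuous_on UNIV G" "wprim (1 / (4 * \<tau>)) G \<in> Cends" "g = dderiv G"
      using fg(2) by (auto simp: Act_iff)
    show ?thesis
      unfolding Act_iff
      by (rule exI[of _ "\<lambda>x. F x + G x"])
         (use F G in \<open>auto simp: wprim_add dderiv_add Cends_add intro: continuous_on_add\<close>)
  qed
  moreover have "(\<lambda>\<phi>. k * f \<phi>) \<in> Act \<tau>" if f: "f \<in> Act \<tau>" for f k
  proof -
    obtain F where F: "continuous_on UNIV F" "wprim (1 / (4 * \<tau>)) F \<in> Cends" "f = dderiv F"
      using f by (auto simp: Act_iff)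
    show ?thesis
      unfolding Act_iff
      by (rule exI[of _ "\<lambda>x. k * F x"])
         (use F in \<open>auto simp: wprim_cmult dderiv_cmult Cends_cmult intro: continuous_on_mult_left\<close>)
  qed
  ultimately show ?thesis unfolding lin_subspace_fun_def by blast
qed

text \<open>Multiply by the reciprocal Gaussian. Since a distribution vanishes off the test
  functions, the product returns f exactly.\<close>

lemma mulw_Ac_imp_Act:
  assumes f: "is_distribution f" and m: "mulw \<tau> f \<in> Ac"
  shows "f \<in> Act \<tau>"
proof -
  have "f \<phi> = 0" if "\<not> test_fun \<phi>" for \<phi>
    using f that unfolding is_distribution_def by blast
  then have "gmul 0 f = f"
    by (auto simp: gmul_def fun_eq_iff)
  then have "f = gmul (- (1 / (4 * \<tau>))) (mulw \<tau> f)"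
    by (simp add: mulw_gmul gmul_gmul)
  then show ?thesis using gmul_Ac_Act[OF m] by metis
qed

section \<open>Inclusions, density and translation\<close>

lemma ActI: "continuous_on UNIV F \<Longrightarrow> wprim (1 / (4 * \<tau>)) F \<in> Cends \<Longrightarrow> dderiv F \<in> Act \<tau>"
  by (auto simp: Act_iff)

lemma ActE:
  assumes "f \<in> Act \<tau>"
  obtains F where "continuous_on UNIV F" "wprim (1 / (4 * \<tau>)) F \<in> Cends" "f = dderiv F"
  using assms by (auto simp: Act_iff)

text \<open>Two continuous primitives differ by a constant, so membership may be tested on any one
  of them. This turns non-membership into a statement about a single explicit function.\<close>

lemma dderiv_Act_iff:
  assumes F: "continuous_on UNIV F"
  shows "dderiv F \<in> Act \<tau> \<longleftrightarrow> wprim (1 / (4 * \<tau>)) F \<in> Cends"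
proof
  assume "dderiv F \<in> Act \<tau>"
  then obtain H where H: "continuous_on UNIV H" "wprim (1 / (4 * \<tau>)) H \<in> Cends" "dderiv F = dderiv H"
    by (rule ActE)
  have "F = (\<lambda>x. H x + (F 0 - H 0))"
  proof
    show "F x = H x + (F 0 - H 0)" for x
      using dderiv_eqD[OF F H(1,3), of x 0] by simp
  qed
  then have "wprim (1 / (4 * \<tau>)) F = (\<lambda>x. wprim (1 / (4 * \<tau>)) H x + (F 0 - H 0))"
    using wprim_add[OF H(1) continuous_on_const, of "1 / (4 * \<tau>)" "F 0 - H 0"] by simp
  then show "wprim (1 / (4 * \<tau>)) F \<in> Cends"
    using Cends_add[OF H(2) Cends_const] by simp
qed (rule ActI[OF F])

lemma dderiv_Ac_iff:
  assumes F: "continuous_on UNIV F"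
  shows "dderiv F \<in> Ac \<longleftrightarrow> F \<in> Cends"
proof -
  have "Ac = Act 0" \<comment> \<open>since 1 / (4 * 0) = 0\<close>
    using Cends_continuous by (simp add: set_eq_iff Ac_iff Act_iff Bex_def) blast
  then show ?thesis using dderiv_Act_iff[OF F, of 0] by simp
qed

lemma Ac_psubset_Act:
  assumes "\<tau> > 0"
  shows "Ac \<subset> Act \<tau>"
proof
  define c where "c = 1 / (4 * \<tau>)"
  have c: "c > 0" using assms by (simp add: c_def)
  show "Ac \<subseteq> Act \<tau>"
    using c by (auto simp: Ac_iff simp flip: c_def intro!: ActI Cends_wprim Cends_continuous)
  \<comment> \<open>The exponent c / 2 lies strictly between 0, the parameter of \<open>Ac\<close>,
    and c.\<close>
  have "wprim c (gauss (- (c / 2))) \<in> Cends" "wprim 0 (gauss (- (c / 2))) \<notin> Cends"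
    using wprim_gauss_Cends[of 0 "c / 2" c] c by auto
  then have "dderiv (gauss (- (c / 2))) \<in> Act \<tau>" "dderiv (gauss (- (c / 2))) \<notin> Ac"
    by (simp_all add: dderiv_Act_iff dderiv_Ac_iff continuous_on_gauss c_def)
  then show "Ac \<noteq> Act \<tau>" by blast
qed

lemma Act_mono:
  assumes "0 < r" "r \<le> s"
  shows "Act s \<subseteq> Act r"
proof
  fix f assume "f \<in> Act s"
  then obtain F where F: "continuous_on UNIV F" "wprim (1 / (4 * s)) F \<in> Cends" "f = dderiv F"
    by (rule ActE)
  have "wprim (1 / (4 * r)) F \<in> Cends"
    by (rule wprim_Cends_mono[OF F(1,2)]) (use assms in \<open>simp add: frac_le\<close>)
  then show "f \<in> Act r" using F by (simp add: ActI)
qed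

lemma Act_psubset_iff:
  assumes "r > 0" "s > 0"
  shows "r < s \<longleftrightarrow> Act s \<subset> Act r"
proof
  assume rs: "r < s"
  define a where "a = 1 / (4 * s)"
  define b where "b = 1 / (4 * r)"
  have ab: "0 \<le> a" "a < (a + b) / 2" "(a + b) / 2 < b"
    using assms rs by (auto simp: a_def b_def field_simps)
  define F where "F = gauss (- ((a + b) / 2))"
  have "dderiv F \<in> Act r" "dderiv F \<notin> Act s"
    using wprim_gauss_Cends[OF ab] by (simp_all add: dderiv_Act_iff continuous_on_gauss F_def a_def b_def)
  then show "Act s \<subset> Act r"
    using Act_mono[of r s] assms rs by auto
next
  \<comment> \<open>The spaces form a chain, so s \<le> r would give the reverse inclusion.\<close>
  assume "Act s \<subset> Act r"
  then have "\<not> Act r \<subseteq> Act s" by auto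
  then show "r < s"
    using Act_mono[of s r] assms(2) by (meson not_le_imp_less)
qed

lemma Act_growth:
  assumes \<tau>: "\<tau> > 0" and f: "f \<in> Act \<tau>"
  defines "F \<equiv> \<lambda>x. prim_t \<tau> f x - prim_t \<tau> f 0"
  shows "\<bar>F x\<bar> \<le> norm_Act \<tau> f * exp (x\<^sup>2 / (4 * \<tau>))"
    and "((\<lambda>x. F x / exp (x\<^sup>2 / (4 * \<tau>))) \<longlongrightarrow> 0) at_infinity"
proof -
  define c where "c = 1 / (4 * \<tau>)"
  have c: "c > 0" using \<tau> by (simp add: c_def)
  have e: "exp (x\<^sup>2 / (4 * \<tau>)) = gauss (- c) x" "gauss c x = 1 / exp (x\<^sup>2 / (4 * \<tau>))" for x
    by (simp_all add: gauss_def c_def exp_minus field_simps)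
  obtain H where H: "H \<in> Bct \<tau>" "f = dderiv H" using f by (auto simp: Act_def)
  have H': "continuous_on UNIV H" "H 0 = 0" "wprim c H \<in> Cends"
    using H(1) by (auto simp: Bct_iff c_def)
  have FH: "F = H" using H H' by (simp add: F_def prim_t_dderiv)
  have n: "norm_Act \<tau> f = bnorm (wprim c H)"
    using H' H(2) by (simp add: norm_Act_dderiv c_def)
  show "\<bar>F x\<bar> \<le> norm_Act \<tau> f * exp (x\<^sup>2 / (4 * \<tau>))"
    using wprim_bound_expand[of "wprim c H" "bnorm (wprim c H)" "- c" x] c H' bnorm_ge[OF H'(3)]
    by (simp add: FH n e(1) wprim_inverse Cends_continuous)
  show "((\<lambda>x. F x / exp (x\<^sup>2 / (4 * \<tau>))) \<longlongrightarrow> 0) at_infinity"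
    using wprim_growth[OF H'(1,3) c] by (simp add: FH e(2))
qed

text \<open>The approximation takes place among the weighted primitives, where the norm is the
  oscillation: clip there and pull back by \<open>wprim (- b)\<close>. The result lies in
  \<open>Act s\<close> because \<open>wprim (a - b)\<close> keeps clipped functions in
  \<open>Cends\<close> for either sign of a - b.\<close>

lemma Act_dense:
  assumes f: "f \<in> Act r" and e: "e > 0"
  shows "\<exists>g \<in> Act s. norm_Act r (\<lambda>\<phi>. f \<phi> - g \<phi>) < e"
proof -
  define a where "a = 1 / (4 * s)"
  define b where "b = 1 / (4 * r)"
  obtain F where F: "continuous_on UNIV F" "wprim b F \<in> Cends" "f = dderiv F"
    using ActE[OF f] unfolding b_def by metis
  define G where "G = wprim b F"
  \<comment> \<open>Oscillation at most doubles a uniform error, so e / 3 still leaves a strict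
    inequality.\<close>
  obtain M where M: "M > 0" "\<And>x. \<bar>G x - clip M G x\<bar> < e / 3"
    using clip_approx[of G "e / 3"] F(2) e by (auto simp: G_def)
  define H where "H = wprim (- b) (clip M G)"
  have cC: "continuous_on UNIV (clip M G)"
    using F(2) by (simp add: G_def continuous_clip Cends_continuous)
  have clip_end: "wprim k (clip M G) \<in> Cends" for k
    by (rule wprim_Cends_of_constant_ends[OF cC, of M]) (use M(1) in \<open>simp add: clip_DERIV\<close>)
  have HC: "continuous_on UNIV H" unfolding H_def by (rule wprim_continuous[OF cC])
  have "wprim a H \<in> Cends"
    unfolding H_def wprim_wprim[OF cC] by (rule clip_end)
  then have "dderiv H \<in> Act s" using HC by (simp add: ActI a_def)
  moreover have "norm_Act r (\<lambda>\<phi>. f \<phi> - dderiv H \<phi>) < e"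
  proof -
    have w: "wprim b (\<lambda>x. F x - H x) = (\<lambda>x. G x - clip M G x)"
      using wprim_diff[OF F(1) HC, of b] wprim_inverse(2)[OF cC, of b]
      by (simp flip: G_def H_def)
    have "norm_Act r (dderiv (\<lambda>x. F x - H x)) = bnorm (wprim b (\<lambda>x. F x - H x))"
      using Cends_diff[OF F(2) clip_end[of 0]] w F(1) HC
      by (simp add: norm_Act_dderiv continuous_on_diff b_def G_def)
    also have "\<dots> \<le> 2 * (e / 3)"
    proof (rule bnorm_le)
      show "\<bar>wprim b (\<lambda>x. F x - H x) x - wprim b (\<lambda>x. F x - H x) y\<bar> \<le> 2 * (e / 3)" for x y
        using M(2)[of x] M(2)[of y] unfolding w by linarith
    qed
    finally show ?thesis using e by (simp add: F(3) dderiv_diff[OF F(1) HC])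
  qed
  ultimately show ?thesis by blast
qed

text \<open>The contraction estimate compares with the single value G 0. The oscillation is
  estimated by passing from x to y through that value, whence the factor 2.\<close>

lemma norm_Act_mono:
  assumes rs: "0 < r" "r \<le> s" and f: "f \<in> Act s"
  shows "norm_Act r f \<le> 2 * norm_Act s f"
proof -
  define a where "a = 1 / (4 * s)"
  define b where "b = 1 / (4 * r)"
  have ab: "a \<le> b" using rs by (simp add: a_def b_def frac_le)
  obtain F where F: "continuous_on UNIV F" "wprim a F \<in> Cends" "f = dderiv F"
    using ActE[OF f] unfolding a_def by metis
  define G where "G = wprim a F"
  have G: "G \<in> Cends" using F(2) by (simp add: G_def)
  have bF: "wprim b F = wprim (b - a) G" unfolding G_def wprim_wprim[OF F(1)] by simp
  have bound: "\<bar>wprim (b - a) G x - G 0\<bar> \<le> bnorm G" for x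
    by (rule wprim_bound_contract[OF Cends_continuous[OF G] bnorm_ge[OF G]]) (use ab in simp)
  have "norm_Act r f = bnorm (wprim (b - a) G)"
    using norm_Act_dderiv[OF F(1), of r] wprim_Cends_mono[OF F(1,2) ab] by (simp add: F(3) bF flip: b_def)
  also have "\<dots> \<le> 2 * bnorm G"
  proof (rule bnorm_le)
    show "\<bar>wprim (b - a) G x - wprim (b - a) G y\<bar> \<le> 2 * bnorm G" for x y
      using bound[of x] bound[of y] by linarith
  qed
  also have "bnorm G = norm_Act s f"
    using norm_Act_dderiv[OF F(1), of s] F(2) by (simp add: F(3) G_def a_def)
  finally show ?thesis .
qed

section \<open>Weighted integrable functions\<close>

lemma L1w_regdist_Act:
  assumes "f \<in> L1w \<tau>"
  shows "regdist f \<in> Act \<tau>"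
proof -
  have f: "f absolutely_integrable_on {a..b}" for a b
    using assms by (simp add: L1w_def)
  have "(\<lambda>x. f x * gauss (1 / (4 * \<tau>)) x) absolutely_integrable_on UNIV"
    using assms by (simp add: L1w_def omega_gauss)
  then have "(\<lambda>x. oint 0 x (\<lambda>\<xi>. f \<xi> * gauss (1 / (4 * \<tau>)) \<xi>)) \<in> Cends"
    by (rule oint_Cends)
  then have "wprim (1 / (4 * \<tau>)) (\<lambda>x. oint 0 x f) \<in> Cends"
    unfolding wprim_oint[OF f, abs_def] .
  then show ?thesis
    using f unfolding regdist_eq_dderiv[OF f]
    by (intro ActI oint_continuous_of_integrable) (auto simp: absolutely_integrable_on_def)
qed

lemma regdist_of_continuous:
  assumes "\<And>x. (F has_real_derivative f x) (at x)" "continuous_on UNIV f"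
  shows "regdist f = dderiv F"
  using integral_parts_test[OF assms] by (auto simp: regdist_def dderiv_def fun_eq_iff)

lemma absolutely_integrable_continuous_support:
  fixes f :: "real \<Rightarrow> real"
  assumes "continuous_on UNIV f" "\<And>x. \<bar>x\<bar> \<ge> L \<Longrightarrow> f x = 0"
  shows "f absolutely_integrable_on UNIV"
proof -
  have "f integrable_on UNIV" if f: "continuous_on UNIV f" "\<And>x. \<bar>x\<bar> \<ge> L \<Longrightarrow> f x = 0" for f :: "real \<Rightarrow> real"
    using has_integral_UNIV_of_support[OF f(2) integrable_integral[OF continuous_integrable_Icc[OF f(1)]]]
    by blast
  from this[OF assms] this[of "\<lambda>x. norm (f x)", OF continuous_on_norm[OF assms(1)]] show ?thesis
    using assms(2) by (simp add: absolutely_integrable_on_def)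
qed

text \<open>Approximate the weighted primitive by K and divide the derivative \<gamma> of K by the
  weight. Then f times the weight is \<gamma>, continuous with bounded support, hence integrable,
  and \<open>wprim (- c) K\<close> is a primitive of f.\<close>

lemma L1w_dense:
  assumes g: "g \<in> Act \<tau>" and e: "e > 0"
  shows "\<exists>f \<in> L1w \<tau>. norm_Act \<tau> (\<lambda>\<phi>. g \<phi> - regdist f \<phi>) < e"
proof -
  define c where "c = 1 / (4 * \<tau>)"
  obtain F where F: "continuous_on UNIV F" "wprim c F \<in> Cends" "g = dderiv F"
    using ActE[OF g] unfolding c_def by metis
  define G where "G = wprim c F"
  obtain K \<gamma> L where K: "\<And>x. \<bar>G x - K x\<bar> < e / 3" "\<And>x. (K has_real_derivative \<gamma> x) (at x)"
    "continuous_on UNIV \<gamma>" "\<And>x. \<bar>x\<bar> \<ge> L \<Longrightarrow> \<gamma> x = 0"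
    using Cends_smooth_approx[of G "e / 3"] F(2) e unfolding G_def by (metis divide_pos_pos zero_less_numeral)
  have KC: "continuous_on UNIV K"
    by (rule continuous_at_imp_continuous_on) (blast intro: DERIV_isCont K(2))
  have "(K has_real_derivative 0) (at x)" if "\<bar>x\<bar> > L" for x
    using K(2)[of x] K(4)[of x] that by simp
  then have KE: "K \<in> Cends"
    using wprim_Cends_of_constant_ends[OF KC, of L 0] by simp
  define f where "f x = \<gamma> x * gauss (- c) x" for x
  have fC: "continuous_on UNIV f"
    unfolding f_def by (intro continuous_intros K(3))
  have "f x * omega \<tau> x = \<gamma> x" for x
    using gauss_add[of "- c" c x] by (simp add: f_def omega_gauss flip: c_def)
  then have "f \<in> L1w \<tau>"
    unfolding L1w_def
    using absolutely_integrable_continuous_support[OF K(3,4)]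
      absolutely_integrable_continuous_real[OF continuous_on_subset[OF fC]]
    by simp
  moreover define H where "H = wprim (- c) K"
  have HC: "continuous_on UNIV H" unfolding H_def by (rule wprim_continuous[OF KC])
  have rH: "regdist f = dderiv H"
    by (rule regdist_of_continuous[OF _ fC]) (simp add: H_def f_def wprim_DERIV[OF KC K(2)])
  have "norm_Act \<tau> (\<lambda>\<phi>. g \<phi> - regdist f \<phi>) < e"
  proof -
    have w: "wprim c (\<lambda>x. F x - H x) = (\<lambda>x. G x - K x)"
      using wprim_diff[OF F(1) HC, of c] wprim_inverse(2)[OF KC, of c]
      by (simp flip: G_def H_def)
    have "norm_Act \<tau> (dderiv (\<lambda>x. F x - H x)) = bnorm (wprim c (\<lambda>x. F x - H x))"
      using Cends_diff[OF F(2) KE] w F(1) HC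
      by (simp add: norm_Act_dderiv continuous_on_diff c_def G_def)
    also have "\<dots> \<le> 2 * (e / 3)"
    proof (rule bnorm_le)
      show "\<bar>wprim c (\<lambda>x. F x - H x) x - wprim c (\<lambda>x. F x - H x) y\<bar> \<le> 2 * (e / 3)" for x y
        using K(1)[of x] K(1)[of y] unfolding w by linarith
    qed
    finally show ?thesis using e by (simp add: F(3) rH dderiv_diff[OF F(1) HC])
  qed
  ultimately show ?thesis by blast
qed

section \<open>Translation\<close>

lemma transl_dderiv:
  assumes F: "continuous_on UNIV F"
  shows "transl a (dderiv F) = dderiv (\<lambda>x. F (x - a))"
proof
  fix \<phi>
  show "transl a (dderiv F) \<phi> = dderiv (\<lambda>x. F (x - a)) \<phi>"
  proof (cases "test_fun \<phi>")
    case True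
    then have T: "test_fun (\<lambda>x. \<phi> (x + a))" by (rule test_fun_shift)
    obtain M where M: "M > 0" "\<And>x. \<bar>x\<bar> \<ge> M \<Longrightarrow> deriv \<phi> x = 0"
      using test_fun_obtain_support[OF True] by metis
    have "(\<phi> has_real_derivative deriv \<phi> (x + a)) (at (x + a))" for x
      using True by (simp add: test_fun_iff smooth_DERIV)
    then have d: "deriv (\<lambda>x. \<phi> (x + a)) = (\<lambda>x. deriv \<phi> (x + a))"
      by (intro ext DERIV_imp_deriv) (simp add: DERIV_shift)
    define k where "k x = F (x - a) * deriv \<phi> x" for x
    have k0: "k x = 0" if "\<bar>x\<bar> \<ge> M" for x using M(2)[OF that] by (simp add: k_def)
    have "smooth (deriv \<phi>)" using True by (simp add: test_fun_iff smooth_deriv)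
    then have kC: "continuous_on UNIV k"
      unfolding k_def
      by (intro continuous_on_mult smooth_continuous continuous_on_compose2[OF F] continuous_intros) auto
    have I: "(k has_integral integral {-M..M} k) {-M..M}"
      by (intro integrable_integral continuous_integrable_Icc kC)
    have "((\<lambda>x. k (x + a)) has_integral integral {-M..M} k) {-M - a..M - a}"
      using has_integral_shift_real_ivl[OF I] .
    then have "((\<lambda>x. k (x + a)) has_integral integral {-M..M} k) UNIV"
      by (rule has_integral_on_superset) (auto intro!: k0)
    moreover have "(k has_integral integral {-M..M} k) UNIV"
      using has_integral_UNIV_of_support[OF k0 I] .
    ultimately have "integral UNIV (\<lambda>x. k (x + a)) = integral UNIV k"
      by (simp add: integral_unique)
    then show ?thesis
      using True T by (simp add: transl_def dderiv_def d k_def[abs_def])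
  qed (simp add: transl_def dderiv_def)
qed

text \<open>The witness is the derivative of exp (c x^2) / (1 + x^2)^2, where c = 1 / (4 tau): shifting it
  by 1 multiplies the growth by exp (2 c x), which violates the growth bound.\<close>

lemma Act_not_translation_invariant:
  assumes "\<tau> > 0"
  shows "\<exists>f \<in> Act \<tau>. transl (- 1) f \<notin> Act \<tau>"
proof -
  define c where "c = 1 / (4 * \<tau>)"
  have c: "c > 0" using assms by (simp add: c_def)
  \<comment> \<open>Without the denominator the weighted primitive would be 1 + c x^2, which is
    unbounded. The square makes the integrand x / (1 + x^2)^2, with the bounded elementary primitive
    - 1 / (2 (1 + x^2)).\<close>
  define F :: "real \<Rightarrow> real" where "F x = gauss (- c) x / (1 + x\<^sup>2)\<^sup>2" for x
  have pos: "1 + x\<^sup>2 \<noteq> 0" for x :: real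
    by (metis add_pos_nonneg less_irrefl zero_le_power2 zero_less_one)
  have FC: "continuous_on UNIV F"
    unfolding F_def using pos by (intro continuous_intros) auto
  have g: "gauss (- c) x * gauss c x = 1" for x
    using gauss_add[of "- c" c x] by simp
  have "wprim c F x = 1 / (1 + x\<^sup>2)\<^sup>2 + c * (1 - 1 / (1 + x\<^sup>2))" for x
  proof -
    have Fg: "F \<xi> * gauss c \<xi> = 1 / (1 + \<xi>\<^sup>2)\<^sup>2" for \<xi>
      using g[of \<xi>] by (simp add: F_def)
    have "F \<xi> * \<xi> * gauss c \<xi> = \<xi> * (F \<xi> * gauss c \<xi>)" for \<xi>
      by simp
    then have integrand: "(\<lambda>\<xi>. F \<xi> * \<xi> * gauss c \<xi>) = (\<lambda>\<xi>. \<xi> / (1 + \<xi>\<^sup>2)\<^sup>2)"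
      unfolding Fg by simp
    have int: "oint 0 x (\<lambda>\<xi>. \<xi> / (1 + \<xi>\<^sup>2)\<^sup>2) = - inverse (1 + x\<^sup>2) / 2 - - inverse (1 + 0\<^sup>2) / 2"
    proof (rule oint_FTC)
      fix x :: real
      have "((\<lambda>x. - inverse (1 + x\<^sup>2) / 2) has_real_derivative
          - (- (inverse (1 + x\<^sup>2) * (2 * x) * inverse (1 + x\<^sup>2))) / 2) (at x)"
        using pos[of x] by (auto intro!: derivative_eq_intros)
      moreover have "- (- (inverse p * (2 * x) * inverse p)) / 2 = x / p\<^sup>2" for p :: real
        by (simp add: field_simps power2_eq_square)
      ultimately show "((\<lambda>x. - inverse (1 + x\<^sup>2) / 2) has_real_derivative x / (1 + x\<^sup>2)\<^sup>2) (at x)"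
        by (simp only:)
    qed
    show ?thesis
      unfolding wprim_def integrand int Fg by (simp add: right_diff_distrib) (simp add: inverse_eq_divide)
  qed
  then have "wprim c F = (\<lambda>x. 1 / (1 + x\<^sup>2)\<^sup>2 + c * (1 - 1 / (1 + x\<^sup>2)))" by auto
  moreover have "((\<lambda>x::real. 1 / (1 + x\<^sup>2)\<^sup>2 + c * (1 - 1 / (1 + x\<^sup>2))) \<longlongrightarrow> c) at_top"
    "((\<lambda>x::real. 1 / (1 + x\<^sup>2)\<^sup>2 + c * (1 - 1 / (1 + x\<^sup>2))) \<longlongrightarrow> c) at_bot"
    by real_asymp+
  ultimately have "wprim c F \<in> Cends"
    using wprim_continuous[OF FC, of c] by (auto simp: Cends_def)
  then have "dderiv F \<in> Act \<tau>" using FC by (simp add: ActI c_def)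
  moreover have "transl (- 1) (dderiv F) \<notin> Act \<tau>"
  proof
    define H where "H x = F (x + 1)" for x
    have HC: "continuous_on UNIV H"
      unfolding H_def by (intro continuous_on_compose2[OF FC] continuous_intros) auto
    assume "transl (- 1) (dderiv F) \<in> Act \<tau>"
    then have "dderiv H \<in> Act \<tau>" by (simp add: transl_dderiv[OF FC] H_def[abs_def])
    then have "wprim c H \<in> Cends" by (simp add: dderiv_Act_iff[OF HC] c_def)
    then have "((\<lambda>x. H x * gauss c x) \<longlongrightarrow> 0) at_infinity"
      by (rule wprim_growth[OF HC _ c])
    then have "((\<lambda>x. H x * gauss c x) \<longlongrightarrow> 0) at_top"
      by (rule tendsto_mono[OF at_top_le_at_infinity])
    moreover have "H x * gauss c x = exp (c * (2 * x + 1)) / (1 + (x + 1)\<^sup>2)\<^sup>2" for x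
      by (simp add: H_def F_def gauss_def algebra_simps power2_eq_square flip: exp_add)
    moreover have "filterlim (\<lambda>x. exp (c * (2 * x + 1)) / (1 + (x + 1)\<^sup>2)\<^sup>2) at_top at_top"
      using c by real_asymp
    ultimately show False
      using not_tendsto_and_filterlim_at_infinity[OF trivial_limit_at_top_linorder _
        filterlim_at_top_imp_at_infinity] by simp
  qed
  ultimately show ?thesis by blast
qed

theorem theorem5p2:
  fixes \<tau> :: real
  assumes tau: "\<tau> > 0"
  shows
    \<comment> \<open>(a)\<close>
    "(banach_fun_on (Bct \<tau>) (norm_Bct \<tau>) \<and> isometric_iso_fun (Bct \<tau>) (norm_Bct \<tau>) Bc bnorm)
   \<comment> \<open>(b)\<close>
   \<and> (banach_fun_on (Act \<tau>) (norm_Act \<tau>) \<and> isometric_iso_fun (Act \<tau>) (norm_Act \<tau>) Ac alex)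
   \<comment> \<open>(c)\<close>
   \<and> (\<forall>f. is_distribution f \<longrightarrow> (f \<in> Act \<tau> \<longleftrightarrow> mulw \<tau> f \<in> Ac))
   \<comment> \<open>(d)\<close>
   \<and> (\<forall>f \<in> Act \<tau>. norm_Act \<tau> f = alex (mulw \<tau> f))
   \<comment> \<open>(e)\<close>
   \<and> Ac \<subset> Act \<tau>
   \<comment> \<open>(f)\<close>
   \<and> (\<forall>r s. r > 0 \<longrightarrow> s > 0 \<longrightarrow> (r < s \<longleftrightarrow> Act s \<subset> Act r))
   \<comment> \<open>(g)\<close>
   \<and> (\<forall>f \<in> Act \<tau>. let F = (\<lambda>x. prim_t \<tau> f x - prim_t \<tau> f 0) in
        (\<forall>x. \<bar>F x\<bar> \<le> norm_Act \<tau> f * exp (x\<^sup>2 / (4 * \<tau>))) \<and>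
        ((\<lambda>x. F x / exp (x\<^sup>2 / (4 * \<tau>))) \<longlongrightarrow> 0) at_infinity)
   \<comment> \<open>(h)\<close>
   \<and> (\<forall>r s. 0 < r \<longrightarrow> r < s \<longrightarrow>
        Act s \<subseteq> Act r \<and> lin_subspace_fun (Act s) \<and>
        (\<forall>f \<in> Act r. \<forall>e > 0. \<exists>g \<in> Act s. norm_Act r (\<lambda>\<phi>. f \<phi> - g \<phi>) < e))
   \<comment> \<open>(i)\<close>
   \<and> (\<forall>r s. 0 < r \<longrightarrow> r < s \<longrightarrow> (\<forall>f \<in> Act s. norm_Act r f \<le> 2 * norm_Act s f))
   \<comment> \<open>(j)\<close>
   \<and> ((\<forall>f \<in> L1w \<tau>. regdist f \<in> Act \<tau>) \<and>
      (\<forall>g \<in> Act \<tau>. \<forall>e > 0. \<exists>f \<in> L1w \<tau>. norm_Act \<tau> (\<lambda>\<phi>. g \<phi> - regdist f \<phi>) < e))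
   \<comment> \<open>(k)\<close>
   \<and> (\<exists>f \<in> Act \<tau>. \<exists>a. transl a f \<notin> Act \<tau>)"
proof (intro conjI)
  show "banach_fun_on (Bct \<tau>) (norm_Bct \<tau>)"
    by (rule banach_fun_on_transfer[OF Bct_iso banach_Bc Bct_lin_subspace])
  show "isometric_iso_fun (Bct \<tau>) (norm_Bct \<tau>) Bc bnorm"
    by (rule Bct_iso)
  show "banach_fun_on (Act \<tau>) (norm_Act \<tau>)"
    \<comment> \<open>Completeness passes in two stages, from \<open>Bc\<close> to \<open>Ac\<close>
      and from \<open>Ac\<close> to \<open>Act \<tau>\<close>.\<close>
    by (intro banach_fun_on_transfer[OF Act_iso _ Act_lin_subspace]
        banach_fun_on_transfer[OF Ac_iso banach_Bc Ac_lin_subspace])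
  show "isometric_iso_fun (Act \<tau>) (norm_Act \<tau>) Ac alex"
    by (rule Act_iso)
  show "\<forall>f. is_distribution f \<longrightarrow> (f \<in> Act \<tau> \<longleftrightarrow> mulw \<tau> f \<in> Ac)"
    using Act_gmul_Ac(1)[of _ \<tau>] mulw_Ac_imp_Act[of _ \<tau>] by (auto simp: mulw_gmul)
  show "\<forall>f \<in> Act \<tau>. norm_Act \<tau> f = alex (mulw \<tau> f)"
    using Act_gmul_Ac(2) by (simp add: mulw_gmul)
  show "Ac \<subset> Act \<tau>"
    by (rule Ac_psubset_Act[OF tau])
  show "\<forall>r s. r > 0 \<longrightarrow> s > 0 \<longrightarrow> (r < s \<longleftrightarrow> Act s \<subset> Act r)"
    by (intro allI impI Act_psubset_iff)
  show "\<forall>f \<in> Act \<tau>. let F = (\<lambda>x. prim_t \<tau> f x - prim_t \<tau> f 0) in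
        (\<forall>x. \<bar>F x\<bar> \<le> norm_Act \<tau> f * exp (x\<^sup>2 / (4 * \<tau>))) \<and>
        ((\<lambda>x. F x / exp (x\<^sup>2 / (4 * \<tau>))) \<longlongrightarrow> 0) at_infinity"
    unfolding Let_def by (intro ballI conjI allI Act_growth[OF tau])
  show "\<forall>r s. 0 < r \<longrightarrow> r < s \<longrightarrow>
        Act s \<subseteq> Act r \<and> lin_subspace_fun (Act s) \<and>
        (\<forall>f \<in> Act r. \<forall>e > 0. \<exists>g \<in> Act s. norm_Act r (\<lambda>\<phi>. f \<phi> - g \<phi>) < e)"
    using Act_mono Act_lin_subspace Act_dense by (simp add: less_imp_le)
  show "\<forall>r s. 0 < r \<longrightarrow> r < s \<longrightarrow> (\<forall>f \<in> Act s. norm_Act r f \<le> 2 * norm_Act s f)"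
    using norm_Act_mono by (simp add: less_imp_le)
  show "\<forall>f \<in> L1w \<tau>. regdist f \<in> Act \<tau>"
    using L1w_regdist_Act by blast
  show "\<forall>g \<in> Act \<tau>. \<forall>e > 0. \<exists>f \<in> L1w \<tau>. norm_Act \<tau> (\<lambda>\<phi>. g \<phi> - regdist f \<phi>) < e"
    using L1w_dense by blast
  show "\<exists>f \<in> Act \<tau>. \<exists>a. transl a f \<notin> Act \<tau>"
    using Act_not_translation_invariant[OF tau] by blast
qed

end
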